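(* There is an algorithm that, given a melon graph $G=(V,E)$, computes the eternal vertex cover number $\mathrm{evc}(G)$ in $\mathcal{O}(|V|+|E|)$ time.
   Context: Eternal vertex cover: let $G=(V,E)$ be a finite graph and $N[u]$ the closed neighborhood of $u$. For a vertex cover $U$ of $G$ and an edge $e=vw$ of $G$, a defense of $U$ against the attack on $e$ is a one-to-one map $\phi:U\to V$ with $\phi(u)\in N[u]$ for every $u\in U$ such that a guard crosses $e$, i.e. $\phi(v)=w$ (with $v\in U$) or $\phi(w)=v$ (with $w\in U$); $U$ is then said to shift to $\phi(U)$. An eternal vertex cover class of $G$ is a family $\mathcal{U}$ of vertex covers of $G$, all of the same cardinality (the size of $\mathcal{U}$), such that for every $U\in\mathcal{U}$ and every edge $e$ of $G$ there is a defense $\phi$ of $U$ against the attack on $e$ with $\phi(U)\in\mathcal{U}$. The eternal vertex cover number $\mathrm{evc}(G)$ is the minimum size of an eternal vertex cover class of $G$. Melon graphs: for an integer $k\ge 1$, a $k$-melon graph is a graph obtained as the union of $k$ paths $P^{(1)},\dots,P^{(k)}$ (each of length at least $1$), all having the same two distinct endpoints $s$ (source) and $t$ (sink), and pairwise internally vertex-disjoint. A melon graph is a $k$-melon graph for some $k\ge1$. *)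

theory Defs
  imports Main
begin

text \<open>
  Finite simple graphs are given by a vertex set \<open>V\<close> and a set \<open>E\<close> of two-element subsets of \<open>V\<close>.
\<close>

definition vertex_cover :: "'a set \<Rightarrow> 'a set set \<Rightarrow> 'a set \<Rightarrow> bool" where
  "vertex_cover V E U \<longleftrightarrow> U \<subseteq> V \<and> (\<forall>e\<in>E. e \<inter> U \<noteq> {})"

definition closed_nbhd :: "'a set \<Rightarrow> 'a set set \<Rightarrow> 'a \<Rightarrow> 'a set" where
  "closed_nbhd V E u = {v \<in> V. v = u \<or> {u, v} \<in> E}"

definition defense :: "'a set \<Rightarrow> 'a set set \<Rightarrow> 'a set \<Rightarrow> 'a \<Rightarrow> 'a \<Rightarrow> ('a \<Rightarrow> 'a) \<Rightarrow> bool" where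
  "defense V E U v w \<phi> \<longleftrightarrow>
     inj_on \<phi> U \<and> (\<forall>u\<in>U. \<phi> u \<in> closed_nbhd V E u) \<and>
     (v \<in> U \<and> \<phi> v = w \<or> w \<in> U \<and> \<phi> w = v)"

text \<open>
  The family has to be nonempty, since otherwise its size is not defined.
\<close>

definition evc_class :: "'a set \<Rightarrow> 'a set set \<Rightarrow> 'a set set \<Rightarrow> nat \<Rightarrow> bool" where
  "evc_class V E \<U> k \<longleftrightarrow>
     \<U> \<noteq> {} \<and> (\<forall>U\<in>\<U>. vertex_cover V E U \<and> card U = k) \<and>
     (\<forall>U\<in>\<U>. \<forall>v w. {v, w} \<in> E \<longrightarrow> (\<exists>\<phi>. defense V E U v w \<phi> \<and> \<phi> ` U \<in> \<U>))"

definition evc :: "'a set \<Rightarrow> 'a set set \<Rightarrow> nat" where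
  "evc V E = (LEAST k. \<exists>\<U>. evc_class V E \<U> k)"

definition path_edges :: "'a list \<Rightarrow> 'a set set" where
  "path_edges xs = {{xs ! i, xs ! Suc i} | i. Suc i < length xs}"

definition k_melon_graph :: "nat \<Rightarrow> 'a set \<Rightarrow> 'a set set \<Rightarrow> bool" where
  "k_melon_graph k V E \<longleftrightarrow>
     (\<exists>s t P. s \<noteq> t \<and>
        (\<forall>i<k. distinct (P i) \<and> length (P i) \<ge> 2 \<and> hd (P i) = s \<and> last (P i) = t) \<and>
        (\<forall>i<k. \<forall>j<k. i \<noteq> j \<longrightarrow> set (P i) \<inter> set (P j) = {s, t}) \<and>
        V = (\<Union>i<k. set (P i)) \<and> E = (\<Union>i<k. path_edges (P i)))"

definition melon_graph :: "'a set \<Rightarrow> 'a set set \<Rightarrow> bool" where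
  "melon_graph V E \<longleftrightarrow> (\<exists>k\<ge>1. k_melon_graph k V E)"

text \<open>
  The set \<open>{V}\<close> is an eternal vertex cover class, so the minimum defining \<^const>\<open>evc\<close> exists.
\<close>

lemma evc_class_all_vertices:
  assumes "\<And>e. e \<in> E \<Longrightarrow> \<exists>u v. u \<noteq> v \<and> u \<in> V \<and> v \<in> V \<and> e = {u, v}"
  shows "evc_class V E {V} (card V)"
proof -
  have "\<exists>\<phi>. defense V E V v w \<phi> \<and> \<phi> ` V = V" if e: "{v, w} \<in> E" for v w
  proof -
    have vw: "v \<in> V" "w \<in> V" using assms[OF e] by (auto simp: doubleton_eq_iff)
    define \<phi> where "\<phi> = id(v := w, w := v)"
    have "defense V E V v w \<phi>"
      using vw e by (auto simp: defense_def closed_nbhd_def \<phi>_def inj_on_def insert_commute)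
    moreover have "\<phi> ` V = V" using vw by (auto simp: \<phi>_def image_iff)
    ultimately show ?thesis by blast
  qed
  moreover have "vertex_cover V E V" using assms by (fastforce simp: vertex_cover_def)
  ultimately show ?thesis by (simp add: evc_class_def)
qed

text \<open>
  The machine model is a unit-cost random access machine with registers, a memory that is
  addressed indirectly through registers, and addition and truncated subtraction as its only
  arithmetic. Programs are structured; they translate into jump programs with constant overhead
  per executed instruction.
  Words are bounded: a step writing a value \<open>\<ge> W\<close> has no semantics, so such a run gets stuck.
\<close>

datatype com =
    Skip
  | Const nat nat
  | Move nat nat
  | Add nat nat nat
  | Sub nat nat nat
  | Load nat nat
  | Store nat nat
  | Seq com com
  | IfNZ nat com com
  | WhileNZ nat com

type_synonym state = "(nat \<Rightarrow> nat) \<times> (nat \<Rightarrow> nat)"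

text \<open>
  \<open>exec W p \<sigma> n \<sigma>'\<close>: with all written words below \<open>W\<close>, the program \<open>p\<close> started in \<open>\<sigma>\<close>
  halts in \<open>\<sigma>'\<close> after \<open>n\<close> steps. A state consists of the registers and the memory.
\<close>

inductive exec :: "nat \<Rightarrow> com \<Rightarrow> state \<Rightarrow> nat \<Rightarrow> state \<Rightarrow> bool" for W :: nat where
  Skip: "exec W Skip \<sigma> 1 \<sigma>"
| Const: "c < W \<Longrightarrow> exec W (Const x c) (r, h) 1 (r(x := c), h)"
| Move: "r y < W \<Longrightarrow> exec W (Move x y) (r, h) 1 (r(x := r y), h)"
| Add: "r y + r z < W \<Longrightarrow> exec W (Add x y z) (r, h) 1 (r(x := r y + r z), h)"
| Sub: "r y - r z < W \<Longrightarrow> exec W (Sub x y z) (r, h) 1 (r(x := r y - r z), h)"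
| Load: "h (r y) < W \<Longrightarrow> exec W (Load x y) (r, h) 1 (r(x := h (r y)), h)"
| Store: "r y < W \<Longrightarrow> exec W (Store x y) (r, h) 1 (r, h(r x := r y))"
| Seq: "exec W p \<sigma> m \<sigma>' \<Longrightarrow> exec W q \<sigma>' n \<sigma>'' \<Longrightarrow> exec W (Seq p q) \<sigma> (m + n) \<sigma>''"
| IfTrue: "fst \<sigma> x \<noteq> 0 \<Longrightarrow> exec W p \<sigma> n \<sigma>' \<Longrightarrow> exec W (IfNZ x p q) \<sigma> (1 + n) \<sigma>'"
| IfFalse: "fst \<sigma> x = 0 \<Longrightarrow> exec W q \<sigma> n \<sigma>' \<Longrightarrow> exec W (IfNZ x p q) \<sigma> (1 + n) \<sigma>'"
| WhileFalse: "fst \<sigma> x = 0 \<Longrightarrow> exec W (WhileNZ x p) \<sigma> 1 \<sigma>"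
| WhileTrue: "fst \<sigma> x \<noteq> 0 \<Longrightarrow> exec W p \<sigma> m \<sigma>' \<Longrightarrow> exec W (WhileNZ x p) \<sigma>' n \<sigma>'' \<Longrightarrow>
    exec W (WhileNZ x p) \<sigma> (1 + m + n) \<sigma>''"

inductive_cases exec_SkipE: "exec W Skip \<sigma> n \<sigma>'"
inductive_cases exec_ConstE: "exec W (Const x c) (r, h) n \<sigma>'"
inductive_cases exec_MoveE: "exec W (Move x y) (r, h) n \<sigma>'"
inductive_cases exec_AddE: "exec W (Add x y z) (r, h) n \<sigma>'"
inductive_cases exec_SubE: "exec W (Sub x y z) (r, h) n \<sigma>'"
inductive_cases exec_LoadE: "exec W (Load x y) (r, h) n \<sigma>'"
inductive_cases exec_StoreE: "exec W (Store x y) (r, h) n \<sigma>'"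
inductive_cases exec_SeqE: "exec W (Seq p q) \<sigma> n \<sigma>'"
inductive_cases exec_IfNZE: "exec W (IfNZ x p q) \<sigma> n \<sigma>'"
inductive_cases exec_WhileNZE: "exec W (WhileNZ x p) \<sigma> n \<sigma>'"

lemma exec_deterministic:
  "exec W p \<sigma> m \<sigma>' \<Longrightarrow> exec W p \<sigma> n \<sigma>'' \<Longrightarrow> n = m \<and> \<sigma>'' = \<sigma>'"
proof (induction arbitrary: n \<sigma>'' rule: exec.induct)
  case Skip
  from Skip.prems show ?case by (rule exec_SkipE) simp
next
  case Const
  from Const.prems show ?case by (rule exec_ConstE) simp
next
  case Move
  from Move.prems show ?case by (rule exec_MoveE) simp
next
  case Add
  from Add.prems show ?case by (rule exec_AddE) simp
next
  case Sub
  from Sub.prems show ?case by (rule exec_SubE) simp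
next
  case Load
  from Load.prems show ?case by (rule exec_LoadE) simp
next
  case Store
  from Store.prems show ?case by (rule exec_StoreE) simp
next
  case (Seq p \<sigma> m \<sigma>' q k \<tau>)
  from Seq.prems obtain m' \<rho> n' where
    *: "n = m' + n'" "exec W p \<sigma> m' \<rho>" "exec W q \<rho> n' \<sigma>''"
    by (rule exec_SeqE)
  from Seq.IH(1)[OF *(2)] have "m' = m" "\<rho> = \<sigma>'" by simp_all
  with Seq.IH(2) *(1,3) show ?case by blast
next
  case (IfTrue \<sigma> x p k \<sigma>' q)
  from IfTrue.prems obtain n' where *: "n = 1 + n'" "exec W p \<sigma> n' \<sigma>''"
    by (rule exec_IfNZE) (use IfTrue.hyps(1) in simp_all)
  with IfTrue.IH show ?case by blast
next
  case (IfFalse \<sigma> x q k \<sigma>' p)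
  from IfFalse.prems obtain n' where *: "n = 1 + n'" "exec W q \<sigma> n' \<sigma>''"
    by (rule exec_IfNZE) (use IfFalse.hyps(1) in simp_all)
  with IfFalse.IH show ?case by blast
next
  case WhileFalse
  from WhileFalse.prems show ?case by (rule exec_WhileNZE) (use WhileFalse.hyps in simp_all)
next
  case (WhileTrue \<sigma> x p m \<sigma>' k \<tau>)
  from WhileTrue.prems obtain m' \<rho> n' where
    *: "n = 1 + m' + n'" "exec W p \<sigma> m' \<rho>" "exec W (WhileNZ x p) \<rho> n' \<sigma>''"
    by (rule exec_WhileNZE) (use WhileTrue.hyps(1) in simp_all)
  from WhileTrue.IH(1)[OF *(2)] have "m' = m" "\<rho> = \<sigma>'" by simp_all
  with WhileTrue.IH(2) *(1,3) show ?case by blast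
qed

text \<open>
  The vertices are numbered in an arbitrary way by the list \<open>vs\<close>, and \<open>adj ! i\<close> lists the numbers
  of the neighbours of \<open>vs ! i\<close> in an arbitrary order.
\<close>

definition adjacency_lists :: "'a set \<Rightarrow> 'a set set \<Rightarrow> 'a list \<Rightarrow> nat list list \<Rightarrow> bool" where
  "adjacency_lists V E vs adj \<longleftrightarrow>
     distinct vs \<and> set vs = V \<and> length adj = length vs \<and>
     (\<forall>i<length vs. distinct (adj ! i) \<and>
        set (adj ! i) = {j. j < length vs \<and> {vs ! i, vs ! j} \<in> E})"

text \<open>
  Memory layout of the input, with \<open>n\<close> the number of vertices: cell \<open>0\<close> holds \<open>n\<close>, cells
  \<open>1, \<dots>, n + 1\<close> hold addresses, and the adjacency lists follow consecutively; the list of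
  vertex number \<open>i\<close> starts at the address in cell \<open>i + 1\<close> and ends before the one in cell \<open>i + 2\<close>.
\<close>

definition encoding :: "nat list list \<Rightarrow> nat list" where
  "encoding adj =
     length adj #
     map (\<lambda>i. length adj + 2 + length (concat (take i adj))) [0..<length adj + 1] @
     concat adj"

definition input_state :: "nat list list \<Rightarrow> state" where
  "input_state adj =
     (\<lambda>_. 0, \<lambda>a. if a < length (encoding adj) then encoding adj ! a else 0)"

definition result :: "state \<Rightarrow> nat" where
  "result \<sigma> = fst \<sigma> 0"

end

theory Submission
  imports Defs
begin

text \<open>
  Let a melon graph have \<open>n\<close> vertices and \<open>k\<close> paths, \<open>e\<close> of them of even length. Its eternal
  vertex cover number is \<open>n - 1\<close> if \<open>k = 1\<close>, \<open>n / 2\<close> rounded up if \<open>k = 2\<close>, and for \<open>k \<ge> 3\<close> it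
  is \<open>(n + e) / 2\<close> if \<open>e \<le> 1\<close> and \<open>(n + 4 - e) / 2\<close> if \<open>e \<ge> 2\<close>.

  For the upper bounds all guard configurations have a fixed parity on the interior of each path:
  the guards stand on all odd or on all even positions. A defense shifts all guards inside some
  paths one step towards the sink and inside some other paths one step towards the source; a guard
  entering \<open>s\<close> or \<open>t\<close> from one path releases the guard there into another one. For \<open>e \<ge> 2\<close> and
  \<open>k \<ge> 3\<close> both \<open>s\<close> and \<open>t\<close> stay occupied and exactly one even path carries a surplus guard, which
  moves on to another even path.

  For the lower bounds, matchings inside the paths bound the size of a vertex cover in terms of the
  guards on \<open>s\<close> and \<open>t\<close>. If \<open>e \<ge> 2\<close> and \<open>k \<ge> 3\<close>, a cover of smaller size contains \<open>s\<close> and \<open>t\<close>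
  and no neighbour of \<open>s\<close> on an even path, so within such covers an attack on an edge from \<open>s\<close> into
  an even path cannot be answered. On a single path, successive attacks on the first unguarded
  vertex fill all but the last one.

  The program reads \<open>k\<close> off the total length of the adjacency lists. If \<open>k \<ge> 3\<close>, the endpoints are
  the vertices of degree at least three, and walking along all paths from one of them yields \<open>e\<close>.
\<close>

subsection \<open>Eternal vertex cover classes\<close>

definition simple_graph :: "'a set \<Rightarrow> 'a set set \<Rightarrow> bool" where
  "simple_graph V E \<longleftrightarrow> finite V \<and> (\<forall>e\<in>E. \<exists>u v. u \<noteq> v \<and> u \<in> V \<and> v \<in> V \<and> e = {u, v})"

lemma simple_graph_edgeD:
  assumes "simple_graph V E" "{u, v} \<in> E"
  shows "u \<noteq> v" "u \<in> V" "v \<in> V"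
  using assms by (auto simp: simple_graph_def doubleton_eq_iff dest!: bspec)

lemma evc_eqI:
  assumes "evc_class V E \<U> k" and "\<And>\<U> k'. evc_class V E \<U> k' \<Longrightarrow> k \<le> k'"
  shows "evc V E = k"
  unfolding evc_def by (rule Least_equality) (use assms in blast)+

lemma evc_class_nonempty:
  assumes "evc_class V E \<U> k"
  obtains U where "U \<in> \<U>"
  using assms unfolding evc_class_def by auto

lemma evc_class_memberD:
  assumes "evc_class V E \<U> k" "U \<in> \<U>"
  shows "vertex_cover V E U" "card U = k"
  using assms by (simp_all add: evc_class_def)

lemma evc_class_defenseE:
  assumes "evc_class V E \<U> k" "U \<in> \<U>" "{v, w} \<in> E"
  obtains \<phi> where "defense V E U v w \<phi>" "\<phi> ` U \<in> \<U>"
  using assms unfolding evc_class_def by meson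

lemma defense_commute: "defense V E U v w \<phi> \<longleftrightarrow> defense V E U w v \<phi>"
  by (auto simp: defense_def)

text \<open>
  Since \<open>U\<close> and \<open>U'\<close> have equal size, a map of \<open>U\<close> onto \<open>U'\<close> is automatically injective.
\<close>

lemma defense_of_moves:
  assumes U: "finite U" "U \<subseteq> V" "card U' = card U"
    and functional: "\<And>u v v'. move u v \<Longrightarrow> move u v' \<Longrightarrow> v = v'"
    and move_edge: "\<And>u v. move u v \<Longrightarrow> v \<in> V \<and> {u, v} \<in> E"
    and covered: "\<And>v. v \<in> U' \<Longrightarrow> (\<exists>u\<in>U. move u v) \<or> v \<in> U \<and> (\<nexists>w. move v w)"
    and crossing: "v \<in> U \<and> move v w \<or> w \<in> U \<and> move w v"
  shows "\<exists>\<phi>. defense V E U v w \<phi> \<and> \<phi> ` U = U'"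
proof -
  define \<phi> where "\<phi> u = (if \<exists>v. move u v then THE v. move u v else u)" for u
  have move_\<phi>: "\<phi> u = v" if "move u v" for u v
    using that functional by (auto simp: \<phi>_def)
  have "U' \<subseteq> \<phi> ` U"
  proof
    fix v assume "v \<in> U'"
    from covered[OF this] show "v \<in> \<phi> ` U"
    proof
      assume "\<exists>u\<in>U. move u v"
      then show ?thesis using move_\<phi> by blast
    next
      assume "v \<in> U \<and> (\<nexists>w. move v w)"
      then show ?thesis by (auto simp: \<phi>_def intro!: image_eqI[of _ _ v])
    qed
  qed
  moreover have "card (\<phi> ` U) \<le> card U'"
    using card_image_le[OF U(1)] U(3) by simp
  ultimately have image: "\<phi> ` U = U'"
    using card_seteq[of "\<phi> ` U" U'] U(1) by blast
  have "\<phi> u \<in> closed_nbhd V E u" if "u \<in> U" for u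
  proof (cases "\<exists>v. move u v")
    case True
    then show ?thesis using move_\<phi> move_edge by (auto simp: closed_nbhd_def)
  next
    case False
    then show ?thesis using that U(2) by (auto simp: \<phi>_def closed_nbhd_def)
  qed
  moreover have "inj_on \<phi> U"
    using eq_card_imp_inj_on[OF U(1)] image U(3) by metis
  ultimately have "defense V E U v w \<phi>"
    using crossing move_\<phi> by (auto simp: defense_def)
  with image show ?thesis by blast
qed

lemma evc_class_all_but_one:
  assumes graph: "simple_graph V E" and "V \<noteq> {}"
  shows "evc_class V E {V - {z} | z. z \<in> V} (card V - 1)"
  unfolding evc_class_def
proof (intro conjI ballI allI impI)
  show "{V - {z} | z. z \<in> V} \<noteq> {}" using \<open>V \<noteq> {}\<close> by blast
next
  fix U assume "U \<in> {V - {z} | z. z \<in> V}"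
  then show "vertex_cover V E U" "card U = card V - 1"
    using graph by (fastforce simp: simple_graph_def vertex_cover_def)+
next
  fix U v w assume "U \<in> {V - {z} | z. z \<in> V}" and edge: "{v, w} \<in> E"
  then obtain z where U: "U = V - {z}" and z: "z \<in> V" by blast
  note vw = simple_graph_edgeD[OF graph edge]
  define \<phi> where "\<phi> = id(v := w, w := v)"
  have "defense V E U v w \<phi>"
    using vw edge U by (auto simp: defense_def closed_nbhd_def \<phi>_def inj_on_def insert_commute)
  moreover have "\<phi> ` U = V - {\<phi> z}"
    using vw z unfolding U by (auto simp: \<phi>_def image_iff)
  moreover have "\<phi> z \<in> V" using vw z by (simp add: \<phi>_def)
  ultimately show "\<exists>\<phi>. defense V E U v w \<phi> \<and> \<phi> ` U \<in> {V - {z} | z. z \<in> V}" by blast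
qed

subsection \<open>Melons as families of indexed paths\<close>

locale melon =
  fixes I :: "'i set" and len :: "'i \<Rightarrow> nat" and x :: "'i \<Rightarrow> nat \<Rightarrow> 'v" and s t :: 'v
  assumes finite_I: "finite I" and I_nonempty: "I \<noteq> {}" and s_neq_t: "s \<noteq> t"
    and len_pos: "i \<in> I \<Longrightarrow> 0 < len i"
    and x_0: "i \<in> I \<Longrightarrow> x i 0 = s" and x_len: "i \<in> I \<Longrightarrow> x i (len i) = t"
    and x_inner: "i \<in> I \<Longrightarrow> 0 < j \<Longrightarrow> j < len i \<Longrightarrow> x i j \<noteq> s \<and> x i j \<noteq> t"
    and x_inj: "i \<in> I \<Longrightarrow> i' \<in> I \<Longrightarrow> 0 < j \<Longrightarrow> j < len i \<Longrightarrow> 0 < j' \<Longrightarrow> j' < len i' \<Longrightarrow>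
      x i j = x i' j' \<Longrightarrow> i = i' \<and> j = j'"
begin

definition inner :: "'i \<Rightarrow> 'v set" where
  "inner i = x i ` {0<..<len i}"

definition verts :: "'v set" where
  "verts = {s, t} \<union> (\<Union>i\<in>I. inner i)"

definition edges :: "'v set set" where
  "edges = {{x i j, x i (Suc j)} | i j. i \<in> I \<and> j < len i}"

definition evens :: "'i set" where
  "evens = {i \<in> I. even (len i)}"

lemma evens_iff: "i \<in> evens \<longleftrightarrow> i \<in> I \<and> even (len i)"
  by (simp add: evens_def)

lemma evens_subset: "evens \<subseteq> I"
  by (auto simp: evens_def)

lemma finite_evens: "finite evens"
  using finite_subset[OF evens_subset finite_I] .

lemma s_in_verts: "s \<in> verts" and t_in_verts: "t \<in> verts"
  by (simp_all add: verts_def)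

lemma x_in_verts: "i \<in> I \<Longrightarrow> j \<le> len i \<Longrightarrow> x i j \<in> verts"
  by (cases "j = 0"; cases "j = len i")
    (auto simp: verts_def inner_def x_0 x_len intro!: bexI[of _ i] imageI)

lemma x_eq_s_iff: "i \<in> I \<Longrightarrow> j \<le> len i \<Longrightarrow> x i j = s \<longleftrightarrow> j = 0"
  by (metis x_0 x_len x_inner s_neq_t le_neq_implies_less neq0_conv)

lemma x_eq_t_iff: "i \<in> I \<Longrightarrow> j \<le> len i \<Longrightarrow> x i j = t \<longleftrightarrow> j = len i"
  by (metis x_0 x_len x_inner s_neq_t le_neq_implies_less neq0_conv)

lemma x_eq_iff:
  assumes "i \<in> I" "j \<le> len i" "i' \<in> I" "j' \<le> len i'"
  shows "x i j = x i' j' \<longleftrightarrow>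
    j = 0 \<and> j' = 0 \<or> j = len i \<and> j' = len i' \<or> i = i' \<and> j = j'"
proof (cases "0 < j \<and> j < len i \<and> 0 < j' \<and> j' < len i'")
  case True
  then show ?thesis using assms x_inj[of i i' j j'] by auto
next
  case False
  then have "x i j \<in> {s, t} \<or> x i' j' \<in> {s, t}"
    using assms x_eq_s_iff x_eq_t_iff by force
  then show ?thesis
    using assms x_eq_s_iff x_eq_t_iff len_pos s_neq_t by (metis insert_iff empty_iff less_not_refl)
qed

lemma inj_on_path: "i \<in> I \<Longrightarrow> inj_on (x i) {..len i}"
  by (rule inj_onI) (use x_eq_iff[of i _ i] in auto)

lemma edgeI: "i \<in> I \<Longrightarrow> j < len i \<Longrightarrow> {x i j, x i (Suc j)} \<in> edges"
  unfolding edges_def by blast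

lemma edge_cases:
  assumes "{u, v} \<in> edges"
  obtains (forward) i j where "i \<in> I" "j < len i" "u = x i j" "v = x i (Suc j)"
    | (backward) i j where "i \<in> I" "j < len i" "u = x i (Suc j)" "v = x i j"
  using assms by (auto simp: edges_def doubleton_eq_iff)

lemma finite_inner [simp]: "finite (inner i)"
  by (simp add: inner_def)

lemma card_inner: "i \<in> I \<Longrightarrow> card (inner i) = len i - 1"
  unfolding inner_def by (subst card_image[OF inj_on_subset[OF inj_on_path]]) auto

lemma s_notin_inner: "i \<in> I \<Longrightarrow> s \<notin> inner i" and t_notin_inner: "i \<in> I \<Longrightarrow> t \<notin> inner i"
  using x_inner[of i] by (auto simp: inner_def image_iff) metis+

lemma inner_disjoint: "i \<in> I \<Longrightarrow> i' \<in> I \<Longrightarrow> i \<noteq> i' \<Longrightarrow> inner i \<inter> inner i' = {}"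
  using x_inj by (fastforce simp: inner_def)

lemma finite_verts: "finite verts"
  using finite_I by (simp add: verts_def)

lemma simple_graph_melon: "simple_graph verts edges"
  unfolding simple_graph_def
proof (intro conjI ballI finite_verts)
  fix e assume "e \<in> edges"
  then obtain i j where ij: "i \<in> I" "j < len i" "e = {x i j, x i (Suc j)}"
    by (auto simp: edges_def)
  then have "x i j \<noteq> x i (Suc j)" using x_eq_iff[of i j i "Suc j"] by simp
  then show "\<exists>u v. u \<noteq> v \<and> u \<in> verts \<and> v \<in> verts \<and> e = {u, v}"
    using ij x_in_verts[of i j] x_in_verts[of i "Suc j"] by auto
qed

lemma card_subset_verts:
  assumes "U \<subseteq> verts"
  shows "card U = of_bool (s \<in> U) + of_bool (t \<in> U) + (\<Sum>i\<in>I. card (U \<inter> inner i))"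
proof -
  have "U = (U \<inter> {s, t}) \<union> (\<Union>i\<in>I. U \<inter> inner i)" using assms by (auto simp: verts_def)
  moreover have "(U \<inter> {s, t}) \<inter> (\<Union>i\<in>I. U \<inter> inner i) = {}"
    using s_notin_inner t_notin_inner by blast
  ultimately have "card U = card (U \<inter> {s, t}) + card (\<Union>i\<in>I. U \<inter> inner i)"
    using finite_I by (metis (no_types, lifting) card_Un_disjoint finite_Int finite_UN finite.emptyI
        finite.insertI finite_inner)
  also have "card (\<Union>i\<in>I. U \<inter> inner i) = (\<Sum>i\<in>I. card (U \<inter> inner i))"
    by (rule card_UN_disjoint) (use finite_I inner_disjoint in \<open>simp, simp, blast\<close>)
  also have "card (U \<inter> {s, t}) = of_bool (s \<in> U) + of_bool (t \<in> U)"
    using s_neq_t by (simp add: Int_insert_right)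
  finally show ?thesis .
qed

lemma card_verts: "card verts = 2 + (\<Sum>i\<in>I. len i - 1)"
proof -
  have "verts \<inter> inner i = inner i" if "i \<in> I" for i using that by (auto simp: verts_def)
  then show ?thesis
    using card_subset_verts[of verts] by (simp add: s_in_verts t_in_verts card_inner)
qed

lemma sum_of_bool_evens: "(\<Sum>i\<in>I. of_bool (even (len i) \<and> Q i)) = card {i \<in> evens. Q i}"
  using finite_I by (simp add: evens_def Int_def conj_ac)

lemma sum_of_bool_even_len: "(\<Sum>i\<in>I. of_bool (even (len i))) = card evens"
  using sum_of_bool_evens[of "\<lambda>_. True"] by simp

end

subsection \<open>Configurations of constant parity inside each path\<close>

datatype 'i config = Config (at_s: bool) (at_t: bool) (on_odd: "'i \<Rightarrow> bool")

lemma card_odd_less: "card {j::nat. 0 < j \<and> j < l \<and> odd j} = l div 2"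
proof -
  have "{j. 0 < j \<and> j < l \<and> odd j} = (\<lambda>h. 2 * h + 1) ` {..<l div 2}"
    by (auto elim!: oddE)
  then show ?thesis by (simp add: card_image inj_on_def)
qed

lemma card_even_less: "card {j::nat. 0 < j \<and> j < l \<and> even j} = (l - 1) div 2"
proof -
  have "{j. 0 < j \<and> j < l \<and> even j} = (\<lambda>h. 2 * h + 2) ` {..<(l - 1) div 2}"
  proof (intro equalityI subsetI)
    fix j assume "j \<in> {j. 0 < j \<and> j < l \<and> even j}"
    then show "j \<in> (\<lambda>h. 2 * h + 2) ` {..<(l - 1) div 2}"
      by (intro image_eqI[of _ _ "j div 2 - 1"]) (auto elim!: evenE)
  qed auto
  then show ?thesis by (simp add: card_image inj_on_def)
qed

context melon
begin

definition guards :: "'i config \<Rightarrow> 'v set" where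
  "guards c = {v. v = s \<and> at_s c} \<union> {v. v = t \<and> at_t c} \<union>
     {x i j | i j. i \<in> I \<and> 0 < j \<and> j < len i \<and> odd j = on_odd c i}"

lemma s_in_guards: "s \<in> guards c \<longleftrightarrow> at_s c" and t_in_guards: "t \<in> guards c \<longleftrightarrow> at_t c"
  using x_inner s_neq_t by (auto simp: guards_def)

lemma x_in_guards: "i \<in> I \<Longrightarrow> 0 < j \<Longrightarrow> j < len i \<Longrightarrow> x i j \<in> guards c \<longleftrightarrow> odd j = on_odd c i"
  using x_inner[of i j] x_inj[of i _ j] by (simp add: guards_def) metis

lemma guards_subset: "guards c \<subseteq> verts"
  by (auto simp: guards_def verts_def inner_def)

lemma finite_guards: "finite (guards c)"
  using finite_subset[OF guards_subset finite_verts] .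

lemma card_guards_inner:
  assumes "i \<in> I"
  shows "card (guards c \<inter> inner i) = (if on_odd c i then len i div 2 else (len i - 1) div 2)"
proof -
  have "guards c \<inter> inner i = x i ` {j. 0 < j \<and> j < len i \<and> odd j = on_odd c i}"
    using x_in_guards[OF assms] by (auto simp: inner_def)
  moreover have "inj_on (x i) {j. 0 < j \<and> j < len i \<and> odd j = on_odd c i}"
    by (rule inj_on_subset[OF inj_on_path[OF assms]]) auto
  ultimately have "card (guards c \<inter> inner i) = card {j. 0 < j \<and> j < len i \<and> odd j = on_odd c i}"
    by (simp add: card_image)
  then show ?thesis by (cases "on_odd c i") (simp_all add: card_odd_less card_even_less)
qed

lemma card_guards:
  "2 * card (guards c) + 2 + card {i \<in> evens. \<not> on_odd c i} =
     card verts + 2 * (of_bool (at_s c) + of_bool (at_t c)) + card {i \<in> evens. on_odd c i}"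
proof -
  have inner: "2 * card (guards c \<inter> inner i) + of_bool (even (len i) \<and> \<not> on_odd c i) =
      (len i - 1) + of_bool (even (len i) \<and> on_odd c i)" if "i \<in> I" for i
    using len_pos[OF that]
    by (cases "even (len i)") (auto simp: card_guards_inner[OF that] elim!: evenE oddE)
  have "(\<Sum>i\<in>I. 2 * card (guards c \<inter> inner i) + of_bool (even (len i) \<and> \<not> on_odd c i)) =
      (\<Sum>i\<in>I. (len i - 1) + of_bool (even (len i) \<and> on_odd c i))"
    by (rule sum.cong[OF refl inner])
  then have "2 * (\<Sum>i\<in>I. card (guards c \<inter> inner i)) + card {i \<in> evens. \<not> on_odd c i} + 2 =
      card verts + card {i \<in> evens. on_odd c i}"
    unfolding sum.distrib sum_of_bool_evens sum_distrib_left[symmetric] card_verts by simp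
  then show ?thesis
    using card_subset_verts[OF guards_subset[of c]] by (simp add: s_in_guards t_in_guards)
qed

lemma vertex_cover_guards:
  assumes "\<And>i. i \<in> I \<Longrightarrow> len i = 1 \<Longrightarrow> at_s c \<or> at_t c"
    and "\<And>i. i \<in> I \<Longrightarrow> 1 < len i \<Longrightarrow> at_s c \<or> on_odd c i"
    and "\<And>i. i \<in> I \<Longrightarrow> 1 < len i \<Longrightarrow> at_t c \<or> even (len i) = on_odd c i"
  shows "vertex_cover verts edges (guards c)"
  unfolding vertex_cover_def
proof (intro conjI ballI guards_subset)
  fix e assume "e \<in> edges"
  then obtain i j where ij: "i \<in> I" "j < len i" and e: "e = {x i j, x i (Suc j)}"
    by (auto simp: edges_def)
  consider (whole) "len i = 1" "j = 0" | (first) "1 < len i" "j = 0"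
    | (last) "1 < len i" "0 < j" "len i = Suc j" | (middle) "0 < j" "Suc j < len i"
    using ij(2) by linarith
  then have "x i j \<in> guards c \<or> x i (Suc j) \<in> guards c"
  proof cases
    case whole
    then show ?thesis
      using assms(1) ij x_0[of i] x_len[of i] by (auto simp: s_in_guards t_in_guards)
  next
    case first
    then show ?thesis
      using assms(2) ij x_0[of i] x_in_guards[of i 1 c] by (auto simp: s_in_guards)
  next
    case last
    then show ?thesis
      using assms(3)[of i] ij x_len[of i] x_in_guards[of i j c] by (auto simp: t_in_guards)
  next
    case middle
    then show ?thesis using ij x_in_guards[of i j c] x_in_guards[of i "Suc j" c] by auto
  qed
  then show "e \<inter> guards c \<noteq> {}" using e by auto
qed

end

subsection \<open>Shifting guards along paths\<close>

context melon
begin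

definition shift_move :: "'i set \<Rightarrow> 'i set \<Rightarrow> 'i config \<Rightarrow> 'v \<Rightarrow> 'v \<Rightarrow> bool" where
  "shift_move R L c u v \<longleftrightarrow>
     (\<exists>i\<in>R. \<exists>j<len i. odd j = on_odd c i \<and> u = x i j \<and> v = x i (Suc j)) \<or>
     (\<exists>i\<in>L. \<exists>j<len i. even j = on_odd c i \<and> u = x i (Suc j) \<and> v = x i j)"

definition shift :: "'i set \<Rightarrow> 'i set \<Rightarrow> 'i config \<Rightarrow> 'i config" where
  "shift R L c = Config
     ((\<exists>i\<in>L. on_odd c i) \<or> at_s c \<and> (\<forall>i\<in>R. on_odd c i))
     ((\<exists>i\<in>R. odd (len i) \<noteq> on_odd c i) \<or> at_t c \<and> (\<forall>i\<in>L. odd (len i) \<noteq> on_odd c i))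
     (\<lambda>i. on_odd c i \<noteq> (i \<in> R \<union> L))"

text \<open>
  A path of \<open>R\<close> with guards on its even positions also pulls the guard at \<open>s\<close>, its position \<open>0\<close>, so
  there is at most one such path; likewise for \<open>L\<close> and \<open>t\<close>.
\<close>

definition legal_shift :: "'i set \<Rightarrow> 'i set \<Rightarrow> 'i config \<Rightarrow> bool" where
  "legal_shift R L c \<longleftrightarrow> R \<subseteq> I \<and> L \<subseteq> I \<and> R \<inter> L = {} \<and>
     (\<forall>i\<in>R. \<not> on_odd c i \<longrightarrow> at_s c \<and> (\<forall>i'\<in>R. \<not> on_odd c i' \<longrightarrow> i' = i)) \<and>
     (\<forall>i\<in>L. odd (len i) = on_odd c i \<longrightarrow> at_t c \<and> (\<forall>i'\<in>L. odd (len i') = on_odd c i' \<longrightarrow> i' = i))"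

lemma legal_shift_disjoint: "legal_shift R L c \<Longrightarrow> R \<subseteq> I \<and> L \<subseteq> I \<and> R \<inter> L = {}"
  by (simp add: legal_shift_def)

lemma legal_shift_source:
  assumes "legal_shift R L c" "i \<in> R" "\<not> on_odd c i"
  shows "at_s c" "i' \<in> R \<Longrightarrow> \<not> on_odd c i' \<Longrightarrow> i' = i"
  using assms by (auto simp: legal_shift_def)

lemma legal_shift_sink:
  assumes "legal_shift R L c" "i \<in> L" "odd (len i) = on_odd c i"
  shows "at_t c" "i' \<in> L \<Longrightarrow> odd (len i') = on_odd c i' \<Longrightarrow> i' = i"
  using assms by (auto simp: legal_shift_def)

lemma shift_move_forward:
  "i \<in> R \<Longrightarrow> j < len i \<Longrightarrow> odd j = on_odd c i \<Longrightarrow> shift_move R L c (x i j) (x i (Suc j))"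
  unfolding shift_move_def by blast

lemma shift_move_backward:
  "i \<in> L \<Longrightarrow> j < len i \<Longrightarrow> even j = on_odd c i \<Longrightarrow> shift_move R L c (x i (Suc j)) (x i j)"
  unfolding shift_move_def by blast

lemma shift_moveE:
  assumes "shift_move R L c u v"
  obtains (forward) i j where "i \<in> R" "j < len i" "odd j = on_odd c i" "u = x i j" "v = x i (Suc j)"
    | (backward) i j where "i \<in> L" "j < len i" "even j = on_odd c i" "u = x i (Suc j)" "v = x i j"
  using assms unfolding shift_move_def by blast

lemma shift_move_guards:
  assumes legal: "legal_shift R L c" and "shift_move R L c u v"
  shows "u \<in> guards c"
  using assms(2)
proof (cases rule: shift_moveE)
  case (forward i j)
  then show ?thesis
    using legal_shift_source(1)[OF legal, of i] legal_shift_disjoint[OF legal] x_0[of i]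
      x_in_guards[of i j c]
    by (cases "j = 0") (auto simp: s_in_guards)
next
  case (backward i j)
  then show ?thesis
    using legal_shift_sink(1)[OF legal, of i] legal_shift_disjoint[OF legal] x_len[of i]
      x_in_guards[of i "Suc j" c]
    by (cases "len i = Suc j") (auto simp: t_in_guards)
qed

lemma legal_shift_forward_eq:
  assumes legal: "legal_shift R L c" and "i \<in> R" "j < len i" "odd j = on_odd c i"
    and "i' \<in> R" "j' < len i'" "odd j' = on_odd c i'" and "x i j = x i' j'"
  shows "i = i' \<and> j = j'"
  using assms(2-) legal_shift_disjoint[OF legal] x_eq_iff[of i j i' j']
    legal_shift_source(2)[OF legal, of i i'] by auto

lemma legal_shift_backward_eq:
  assumes legal: "legal_shift R L c" and i: "i \<in> L" "j < len i" "even j = on_odd c i"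
    and i': "i' \<in> L" "j' < len i'" "even j' = on_odd c i'" and eq: "x i (Suc j) = x i' (Suc j')"
  shows "i = i' \<and> j = j'"
proof (cases "Suc j = len i \<and> Suc j' = len i'")
  case True
  then have "odd (len i) = on_odd c i" "odd (len i') = on_odd c i'"
    using i(3) i'(3) by (metis even_Suc)+
  then show ?thesis using True i(1) i'(1) legal_shift_sink(2)[OF legal, of i i'] by auto
next
  case False
  then show ?thesis
    using i i' eq legal_shift_disjoint[OF legal] x_eq_iff[of i "Suc j" i' "Suc j'"] by auto
qed

lemma legal_shift_forward_neq_backward:
  assumes "legal_shift R L c" "i \<in> R" "j < len i" "i' \<in> L" "j' < len i'"
  shows "x i j \<noteq> x i' (Suc j')"
  using assms legal_shift_disjoint[OF assms(1)] x_eq_iff[of i j i' "Suc j'"] by auto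

lemma shift_move_functional:
  assumes legal: "legal_shift R L c" and uv: "shift_move R L c u v" and uv': "shift_move R L c u v'"
  shows "v = v'"
  using uv
proof (cases rule: shift_moveE)
  case u: (forward i j)
  from uv' show ?thesis
  proof (cases rule: shift_moveE)
    case (forward i' j')
    then show ?thesis using u legal_shift_forward_eq[OF legal, of i j i' j'] by auto
  next
    case (backward i' j')
    then show ?thesis using u legal_shift_forward_neq_backward[OF legal, of i j i' j'] by auto
  qed
next
  case u: (backward i j)
  from uv' show ?thesis
  proof (cases rule: shift_moveE)
    case (forward i' j')
    then show ?thesis using u legal_shift_forward_neq_backward[OF legal, of i' j' i j] by auto
  next
    case (backward i' j')
    then show ?thesis using u legal_shift_backward_eq[OF legal, of i j i' j'] by auto
  qed
qed

lemma shift_move_edge: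
  assumes "legal_shift R L c" "shift_move R L c u v"
  shows "v \<in> verts \<and> {u, v} \<in> edges"
proof -
  have "{u, v} \<in> edges"
    using assms(2) legal_shift_disjoint[OF assms(1)] edgeI
    unfolding shift_move_def by (auto simp: insert_commute)
  then show ?thesis using simple_graph_edgeD[OF simple_graph_melon] by blast
qed

lemma shift_move_from_s:
  assumes "R \<subseteq> I" "L \<subseteq> I" "shift_move R L c s w"
  shows "\<exists>i\<in>R. \<not> on_odd c i"
  using assms(3)
proof (cases rule: shift_moveE)
  case (forward i j)
  then have "j = 0" using assms(1) x_eq_s_iff[of i j] by auto
  then show ?thesis using forward by auto
next
  case (backward i j)
  then show ?thesis using assms(2) x_eq_s_iff[of i "Suc j"] by auto
qed

lemma shift_move_from_t:
  assumes "R \<subseteq> I" "L \<subseteq> I" "shift_move R L c t w"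
  shows "\<exists>i\<in>L. odd (len i) = on_odd c i"
  using assms(3)
proof (cases rule: shift_moveE)
  case (forward i j)
  then show ?thesis using assms(1) x_eq_t_iff[of i j] by auto
next
  case (backward i j)
  then have "Suc j = len i" using assms(2) x_eq_t_iff[of i "Suc j"] by auto
  then show ?thesis using backward(1,3) by (metis even_Suc)
qed

lemma shift_move_from_inner:
  assumes "R \<subseteq> I" "L \<subseteq> I" "shift_move R L c (x i j) w" "i \<in> I" "0 < j" "j < len i"
  shows "i \<in> R \<union> L"
  using assms(3)
proof (cases rule: shift_moveE)
  case (forward i' j')
  then show ?thesis using assms x_eq_iff[of i j i' j'] by auto
next
  case (backward i' j')
  then show ?thesis using assms x_eq_iff[of i j i' "Suc j'"] by auto
qed

lemma shift_covered_inner: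
  assumes legal: "legal_shift R L c" and i: "i \<in> I" "0 < j" "j < len i"
    and parity: "odd j = (on_odd c i \<noteq> (i \<in> R \<union> L))"
  shows "(\<exists>u. shift_move R L c u (x i j)) \<or> x i j \<in> guards c \<and> (\<nexists>w. shift_move R L c (x i j) w)"
proof -
  note sub = legal_shift_disjoint[OF legal]
  consider (forward) "i \<in> R" | (backward) "i \<in> L" | (stay) "i \<notin> R \<union> L" by blast
  then show ?thesis
  proof cases
    case forward
    then have "shift_move R L c (x i (j - 1)) (x i j)"
      using i parity shift_move_forward[of i R "j - 1" c L] by auto
    then show ?thesis by blast
  next
    case backward
    then have "shift_move R L c (x i (Suc j)) (x i j)"
      using i parity sub shift_move_backward[of i L j c R] by auto
    then show ?thesis by blast
  next
    case stay
    then show ?thesis using i parity sub shift_move_from_inner x_in_guards[of i j c] by blast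
  qed
qed

lemma shift_covered:
  assumes legal: "legal_shift R L c" and v: "v \<in> guards (shift R L c)"
  shows "(\<exists>u. shift_move R L c u v) \<or> v \<in> guards c \<and> (\<nexists>w. shift_move R L c v w)"
proof -
  note sub = legal_shift_disjoint[OF legal]
  consider (enter_s) i where "v = s" "i \<in> L" "on_odd c i"
    | (stay_s) "v = s" "at_s c" "\<forall>i\<in>R. on_odd c i"
    | (enter_t) i where "v = t" "i \<in> R" "odd (len i) \<noteq> on_odd c i"
    | (stay_t) "v = t" "at_t c" "\<forall>i\<in>L. odd (len i) \<noteq> on_odd c i"
    | (inner) i j where "v = x i j" "i \<in> I" "0 < j" "j < len i" "odd j = (on_odd c i \<noteq> (i \<in> R \<union> L))"
    using v unfolding guards_def shift_def Un_iff mem_Collect_eq config.sel by blast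
  then show ?thesis
  proof cases
    case enter_s
    then have "shift_move R L c (x i 1) v"
      using sub len_pos[of i] x_0[of i] shift_move_backward[of i L 0 c R] by auto
    then show ?thesis by blast
  next
    case stay_s
    then show ?thesis using sub shift_move_from_s[of R L c] s_in_guards by blast
  next
    case enter_t
    then have "shift_move R L c (x i (len i - 1)) v"
      using sub len_pos[of i] x_len[of i] shift_move_forward[of i R "len i - 1" c L] by auto
    then show ?thesis by blast
  next
    case stay_t
    then show ?thesis using sub shift_move_from_t[of R L c] t_in_guards by blast
  next
    case inner
    then show ?thesis using shift_covered_inner[OF legal] by simp
  qed
qed

definition feasible_shift :: "'i config set \<Rightarrow> 'i set \<Rightarrow> 'i set \<Rightarrow> 'i config \<Rightarrow> bool" where
  "feasible_shift \<C> R L c \<longleftrightarrow> legal_shift R L c \<and> shift R L c \<in> \<C>"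

text \<open>
  Exactly one end of each edge of path \<open>i\<close> has the parity of the guards on that path, so an attack
  prescribes the direction in which path \<open>i\<close> has to shift, and nothing else.
\<close>

definition shift_closed :: "'i config set \<Rightarrow> bool" where
  "shift_closed \<C> \<longleftrightarrow> (\<forall>c\<in>\<C>. \<forall>i\<in>I.
     (\<exists>R L. i \<in> R \<and> feasible_shift \<C> R L c) \<and> (\<exists>R L. i \<in> L \<and> feasible_shift \<C> R L c))"

lemma shift_closedI:
  assumes "\<And>c i. c \<in> \<C> \<Longrightarrow> i \<in> I \<Longrightarrow> \<exists>R L. i \<in> R \<and> feasible_shift \<C> R L c"
    and "\<And>c i. c \<in> \<C> \<Longrightarrow> i \<in> I \<Longrightarrow> \<exists>R L. i \<in> L \<and> feasible_shift \<C> R L c"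
  shows "shift_closed \<C>"
  using assms by (simp add: shift_closed_def)

lemma defense_shift:
  assumes legal: "legal_shift R L c" and card: "card (guards (shift R L c)) = card (guards c)"
    and attack: "j < len i" "if odd j = on_odd c i then i \<in> R else i \<in> L"
  shows "\<exists>\<phi>. defense verts edges (guards c) (x i j) (x i (Suc j)) \<phi> \<and>
    \<phi> ` guards c = guards (shift R L c)"
proof (rule defense_of_moves[where move = "shift_move R L c"])
  have "shift_move R L c (x i j) (x i (Suc j)) \<or> shift_move R L c (x i (Suc j)) (x i j)"
    using attack unfolding shift_move_def by (auto split: if_splits)
  then show "x i j \<in> guards c \<and> shift_move R L c (x i j) (x i (Suc j)) \<or>
      x i (Suc j) \<in> guards c \<and> shift_move R L c (x i (Suc j)) (x i j)"
    using shift_move_guards[OF legal] by blast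
next
  fix v assume "v \<in> guards (shift R L c)"
  from shift_covered[OF legal this]
  show "(\<exists>u\<in>guards c. shift_move R L c u v) \<or> v \<in> guards c \<and> (\<nexists>w. shift_move R L c v w)"
    using shift_move_guards[OF legal] by blast
qed (fact finite_guards guards_subset card shift_move_functional[OF legal]
    shift_move_edge[OF legal])+

lemma evc_class_shift_closed:
  assumes "\<C> \<noteq> {}" and cover: "\<And>c. c \<in> \<C> \<Longrightarrow> vertex_cover verts edges (guards c)"
    and card: "\<And>c. c \<in> \<C> \<Longrightarrow> card (guards c) = K" and closed: "shift_closed \<C>"
  shows "evc_class verts edges (guards ` \<C>) K"
  unfolding evc_class_def
proof (intro conjI ballI allI impI)
  show "guards ` \<C> \<noteq> {}" using assms(1) by simp
next
  fix U assume "U \<in> guards ` \<C>"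
  then show "vertex_cover verts edges U" "card U = K" using cover card by blast+
next
  fix U v w assume "U \<in> guards ` \<C>" and "{v, w} \<in> edges"
  then obtain c where c: "c \<in> \<C>" "U = guards c" by blast
  have attack: "\<exists>\<phi>. defense verts edges U (x i j) (x i (Suc j)) \<phi> \<and> \<phi> ` U \<in> guards ` \<C>"
    if i: "i \<in> I" and j: "j < len i" for i j
  proof -
    obtain R L where "if odd j = on_odd c i then i \<in> R else i \<in> L"
      and legal: "legal_shift R L c" "shift R L c \<in> \<C>"
      using closed[unfolded shift_closed_def, rule_format, OF c(1) i]
      by (cases "odd j = on_odd c i") (auto simp: feasible_shift_def)
    moreover have "card (guards (shift R L c)) = card (guards c)" using card c(1) legal(2) by simp
    ultimately show ?thesis using defense_shift[OF legal(1)] j c(2) by (metis image_eqI)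
  qed
  from \<open>{v, w} \<in> edges\<close> show "\<exists>\<phi>. defense verts edges U v w \<phi> \<and> \<phi> ` U \<in> guards ` \<C>"
    by (cases rule: edge_cases) (use attack defense_commute in metis)+
qed

end

subsection \<open>Upper bounds\<close>

lemma card_ge_two_obtain_other:
  assumes "2 \<le> card A"
  obtains b where "b \<in> A" "b \<noteq> a"
proof -
  have "\<not> A \<subseteq> {a}" using assms card_mono[of "{a}" A] by auto
  then show ?thesis using that by blast
qed

context melon
begin

definition odd_configs :: "'i config set" where
  "odd_configs = {c. at_s c \<noteq> at_t c \<and> (\<forall>i\<in>I. on_odd c i = at_t c)}"

lemma feasible_shift_odd_configs:
  assumes "evens = {}" "c \<in> odd_configs" "p \<in> I"
  shows "at_s c \<Longrightarrow> feasible_shift odd_configs {p} (I - {p}) c"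
    and "at_t c \<Longrightarrow> feasible_shift odd_configs (I - {p}) {p} c"
  using assms by (auto simp: feasible_shift_def odd_configs_def legal_shift_def shift_def evens_def)

lemma shift_closed_odd_configs:
  assumes k: "2 \<le> card I" and ev: "evens = {}"
  shows "shift_closed odd_configs"
proof (rule shift_closedI)
  fix c i assume c: "c \<in> odd_configs" and i: "i \<in> I"
  note feasible = feasible_shift_odd_configs[OF ev c]
  obtain p where p: "p \<in> I" "i \<in> I - {p}" using card_ge_two_obtain_other[OF k] i by blast
  have "at_s c \<or> at_t c" using c by (auto simp: odd_configs_def)
  then show "\<exists>R L. i \<in> R \<and> feasible_shift odd_configs R L c"
    using feasible(1)[OF i] feasible(2)[OF p(1)] p(2) by (metis singletonI)
  show "\<exists>R L. i \<in> L \<and> feasible_shift odd_configs R L c"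
    using \<open>at_s c \<or> at_t c\<close> feasible(1)[OF p(1)] feasible(2)[OF i] p(2) by (metis singletonI)
qed

lemma evc_class_no_even:
  assumes k: "2 \<le> card I" and ev: "evens = {}" and K: "2 * K = card verts"
  shows "evc_class verts edges (guards ` odd_configs) K"
proof (rule evc_class_shift_closed)
  show "odd_configs \<noteq> {}"
    by (auto simp: odd_configs_def intro!: exI[of _ "Config True False (\<lambda>_. False)"])
next
  fix c assume c: "c \<in> odd_configs"
  show "vertex_cover verts edges (guards c)"
    by (rule vertex_cover_guards) (use c ev in \<open>auto simp: odd_configs_def evens_def\<close>)
  show "card (guards c) = K"
    using card_guards[of c] c K ev by (auto simp: odd_configs_def)
qed (rule shift_closed_odd_configs[OF k ev])

definition two_even_configs :: "'i config set" where
  "two_even_configs = {c. (\<forall>i\<in>I. on_odd c i = (\<not> at_s c)) \<and> at_t c = at_s c}"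

lemma feasible_shift_two_even_configs:
  assumes "I = {p, q}" "p \<noteq> q" "evens = I" "c \<in> two_even_configs"
  shows "feasible_shift two_even_configs {p} {q} c"
proof -
  have "p \<in> I" "q \<in> I" using assms(1) by simp_all
  moreover from this have "even (len p)" "even (len q)" using assms(3) evens_iff by blast+
  moreover have "i = p \<or> i = q" if "i \<in> I" for i using assms(1) that by simp
  ultimately show ?thesis
    using assms(2,4)
    by (auto simp: feasible_shift_def two_even_configs_def legal_shift_def shift_def)
qed

lemma evc_class_two_even:
  assumes k: "card I = 2" and ev: "evens = I" and K: "2 * K = card verts"
  shows "evc_class verts edges (guards ` two_even_configs) K"
proof (rule evc_class_shift_closed)
  show "two_even_configs \<noteq> {}"
    by (auto simp: two_even_configs_def intro!: exI[of _ "Config True True (\<lambda>_. False)"])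
next
  fix c assume c: "c \<in> two_even_configs"
  have even_len: "even (len i)" if "i \<in> I" for i using ev that evens_iff by blast
  show "vertex_cover verts edges (guards c)"
    by (rule vertex_cover_guards) (use c even_len in \<open>force simp: two_even_configs_def\<close>)+
  have "card {i \<in> evens. on_odd c i} = (if at_s c then 0 else 2)"
    "card {i \<in> evens. \<not> on_odd c i} = (if at_s c then 2 else 0)"
    using c k unfolding ev by (simp_all add: two_even_configs_def cong: conj_cong)
  moreover have "at_t c = at_s c" using c by (simp add: two_even_configs_def)
  ultimately show "card (guards c) = K"
    using card_guards[of c] K k by (cases "at_s c") simp_all
next
  obtain p q where I: "I = {p, q}" "p \<noteq> q" using k by (meson card_2_iff)
  then have "I = {q, p}" "q \<noteq> p" by auto
  note feasible =
    feasible_shift_two_even_configs[OF I ev] feasible_shift_two_even_configs[OF this ev]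
  show "shift_closed two_even_configs"
    by (rule shift_closedI) (use feasible I(1) in blast)+
qed

definition one_even_both :: "'i \<Rightarrow> 'i config set" where
  "one_even_both q = {c. at_s c \<and> at_t c \<and> \<not> on_odd c q}"

definition one_even_source :: "'i \<Rightarrow> 'i config set" where
  "one_even_source q = {c. at_s c \<and> \<not> at_t c \<and> (\<forall>i\<in>I. on_odd c i = (i = q))}"

definition one_even_sink :: "'i config set" where
  "one_even_sink = {c. \<not> at_s c \<and> at_t c \<and> (\<forall>i\<in>I. on_odd c i)}"

definition one_even_configs :: "'i \<Rightarrow> 'i config set" where
  "one_even_configs q = one_even_both q \<union> one_even_source q \<union> one_even_sink"

lemmas one_even_defs = one_even_configs_def one_even_both_def one_even_source_def one_even_sink_def

lemma evens_singletonD: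
  assumes "evens = {q}"
  shows "q \<in> I" "even (len q)" "i \<in> I \<Longrightarrow> i \<noteq> q \<Longrightarrow> odd (len i)"
  using assms by (auto simp: evens_def)

lemma one_even_both_shift_even:
  assumes "evens = {q}" "c \<in> one_even_both q"
  shows "feasible_shift (one_even_configs q) {q} {i \<in> I - {q}. \<not> on_odd c i} c"
    and "feasible_shift (one_even_configs q) {i \<in> I - {q}. on_odd c i} {q} c"
  using assms(2) evens_singletonD[OF assms(1)]
  by (auto simp: feasible_shift_def one_even_defs legal_shift_def shift_def)

lemma one_even_both_shift_odd:
  assumes "evens = {q}" "c \<in> one_even_both q" "i \<in> I" "i \<noteq> q"
  shows "on_odd c i \<Longrightarrow> feasible_shift (one_even_configs q) {i} {} c"
    and "on_odd c i \<Longrightarrow>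
      feasible_shift (one_even_configs q) (insert q {p \<in> I - {q, i}. on_odd c p}) {i} c"
    and "\<not> on_odd c i \<Longrightarrow> feasible_shift (one_even_configs q) {} {i} c"
    and "\<not> on_odd c i \<Longrightarrow>
      feasible_shift (one_even_configs q) {i} (insert q {p \<in> I - {q, i}. \<not> on_odd c p}) c"
  using assms(2-) evens_singletonD[OF assms(1)]
  by (auto simp: feasible_shift_def one_even_defs legal_shift_def shift_def)

lemma one_even_end_shift:
  assumes "evens = {q}" "c \<in> one_even_source q \<union> one_even_sink" "p \<in> I" "p \<noteq> q"
  shows "feasible_shift (one_even_configs q) {p} {q} c"
    and "feasible_shift (one_even_configs q) {q} {p} c"
  using assms(2-) evens_singletonD[OF assms(1)]
  by (auto simp: feasible_shift_def one_even_defs legal_shift_def shift_def)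

lemma shift_closed_one_even_configs:
  assumes k: "2 \<le> card I" and ev: "evens = {q}"
  shows "shift_closed (one_even_configs q)"
proof -
  let ?C = "one_even_configs q"
  have "(\<exists>R L. i \<in> R \<and> feasible_shift ?C R L c) \<and> (\<exists>R L. i \<in> L \<and> feasible_shift ?C R L c)"
    if c: "c \<in> ?C" and i: "i \<in> I" for c i
  proof -
    obtain r where r: "r \<in> I" "r \<noteq> q" by (rule card_ge_two_obtain_other[OF k])
    consider (both_even) "c \<in> one_even_both q" "i = q" | (both_odd) "c \<in> one_even_both q" "i \<noteq> q"
      | (one_end) "c \<in> one_even_source q \<union> one_even_sink"
      using c by (auto simp: one_even_configs_def)
    then show ?thesis
    proof cases
      case both_even
      then show ?thesis using one_even_both_shift_even[OF ev] by blast
    next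
      case both_odd
      then show ?thesis
        using one_even_both_shift_odd[OF ev both_odd(1) i both_odd(2)]
        by (cases "on_odd c i") blast+
    next
      case one_end
      then show ?thesis
        using one_even_end_shift[OF ev one_end r] one_even_end_shift[OF ev one_end i]
        by (cases "i = q") blast+
    qed
  qed
  then show ?thesis by (intro shift_closedI) blast+
qed

lemma evc_class_one_even:
  assumes k: "2 \<le> card I" and ev: "evens = {q}" and K: "2 * K = card verts + 1"
  shows "evc_class verts edges (guards ` one_even_configs q) K"
proof (rule evc_class_shift_closed)
  show "one_even_configs q \<noteq> {}"
    by (auto simp: one_even_defs intro!: exI[of _ "Config True True (\<lambda>_. False)"])
next
  note q = evens_singletonD[OF ev]
  fix c assume c: "c \<in> one_even_configs q"
  have "even (len i) = on_odd c i" if "i \<in> I" "\<not> at_t c" for i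
    using that c q by (cases "i = q") (auto simp: one_even_defs)
  then show "vertex_cover verts edges (guards c)"
    by (intro vertex_cover_guards) (use c in \<open>auto simp: one_even_defs\<close>)
  have "{i \<in> evens. P i} = (if P q then {q} else {})" for P using ev by auto
  then show "card (guards c) = K"
    using card_guards[of c] c K q(1) by (auto simp: one_even_defs)
qed (rule shift_closed_one_even_configs[OF k ev])

text \<open>
  Inside a path of even length the odd positions outnumber the even ones by one, so \<open>q\<close> is the only
  even path that carries a surplus guard.
\<close>

definition surplus_configs :: "'i \<Rightarrow> 'i config set" where
  "surplus_configs q = {c. at_s c \<and> at_t c \<and> (\<forall>i\<in>evens. on_odd c i = (i = q))}"

definition many_even_configs :: "'i config set" where
  "many_even_configs = (\<Union>q\<in>evens. surplus_configs q)"

lemma surplus_shift_even: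
  assumes "c \<in> surplus_configs q" "q \<in> evens" "p \<in> evens" "p \<noteq> q"
  shows "feasible_shift many_even_configs {p} {q} c"
    and "feasible_shift many_even_configs {q} {p} c"
  unfolding feasible_shift_def many_even_configs_def
  using assms
  by (auto simp: surplus_configs_def legal_shift_def shift_def evens_iff intro!: bexI[of _ p])

lemma surplus_shift_odd:
  assumes "c \<in> surplus_configs q" "q \<in> evens" "p \<in> evens" "p \<noteq> q" "i \<in> I - evens"
  shows "on_odd c i \<Longrightarrow> feasible_shift many_even_configs {i} {} c"
    and "on_odd c i \<Longrightarrow> feasible_shift many_even_configs {q, p} {i} c"
    and "\<not> on_odd c i \<Longrightarrow> feasible_shift many_even_configs {} {i} c"
    and "\<not> on_odd c i \<Longrightarrow> feasible_shift many_even_configs {i} {q, p} c"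
proof -
  have i: "i \<in> I" "i \<notin> evens" "odd (len i)" "i \<noteq> q" "i \<noteq> p"
    and pq: "p \<in> I" "even (len p)" "q \<in> I" "even (len q)"
    using assms(2,3,5) by (auto simp: evens_iff)
  have c: "at_s c" "at_t c" "on_odd c q" "\<not> on_odd c p"
    and surplus: "\<And>r. r \<in> evens \<Longrightarrow> on_odd c r = (r = q)"
    using assms(1-4) by (simp_all add: surplus_configs_def)
  note simps = surplus_configs_def legal_shift_def shift_def
  have "legal_shift {i} {} c \<and> shift {i} {} c \<in> surplus_configs q"
    "legal_shift {q, p} {i} c \<and> shift {q, p} {i} c \<in> surplus_configs p" if "on_odd c i"
    using that i pq c assms(4) by (auto simp: simps surplus)
  moreover have "legal_shift {} {i} c \<and> shift {} {i} c \<in> surplus_configs q"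
    "legal_shift {i} {q, p} c \<and> shift {i} {q, p} c \<in> surplus_configs p" if "\<not> on_odd c i"
    using that i pq c assms(4) by (auto simp: simps surplus)
  ultimately show "on_odd c i \<Longrightarrow> feasible_shift many_even_configs {i} {} c"
    and "on_odd c i \<Longrightarrow> feasible_shift many_even_configs {q, p} {i} c"
    and "\<not> on_odd c i \<Longrightarrow> feasible_shift many_even_configs {} {i} c"
    and "\<not> on_odd c i \<Longrightarrow> feasible_shift many_even_configs {i} {q, p} c"
    using assms(2,3) unfolding feasible_shift_def many_even_configs_def by blast+
qed

lemma shift_closed_many_even_configs:
  assumes ev: "2 \<le> card evens"
  shows "shift_closed many_even_configs"
proof -
  let ?C = "many_even_configs"
  have "(\<exists>R L. i \<in> R \<and> feasible_shift ?C R L c) \<and> (\<exists>R L. i \<in> L \<and> feasible_shift ?C R L c)"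
    if c: "c \<in> ?C" and i: "i \<in> I" for c i
  proof -
    obtain q where q: "c \<in> surplus_configs q" "q \<in> evens"
      using c by (auto simp: many_even_configs_def)
    obtain r where r: "r \<in> evens" "r \<noteq> q" by (rule card_ge_two_obtain_other[OF ev])
    show ?thesis
    proof (cases "i \<in> evens")
      case True
      then show ?thesis
        using surplus_shift_even[OF q r] surplus_shift_even[OF q True] by (cases "i = q") blast+
    next
      case False
      then have "i \<in> I - evens" using i by simp
      then show ?thesis using surplus_shift_odd[OF q r] by (cases "on_odd c i") blast+
    qed
  qed
  then show ?thesis by (intro shift_closedI) blast+
qed

lemma evc_class_many_even:
  assumes ev: "2 \<le> card evens" and K: "2 * K + card evens = card verts + 4"
  shows "evc_class verts edges (guards ` many_even_configs) K"
proof (rule evc_class_shift_closed)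
  obtain q where "q \<in> evens" using card_ge_two_obtain_other[OF ev] by blast
  then show "many_even_configs \<noteq> {}"
    by (auto simp: many_even_configs_def surplus_configs_def
        intro!: exI[of _ "Config True True (\<lambda>i. i = q)"])
next
  fix c assume "c \<in> many_even_configs"
  then obtain q where q: "c \<in> surplus_configs q" "q \<in> evens"
    by (auto simp: many_even_configs_def)
  show "vertex_cover verts edges (guards c)"
    by (rule vertex_cover_guards) (use q in \<open>auto simp: surplus_configs_def\<close>)
  have "{i \<in> evens. on_odd c i} = {q}" "{i \<in> evens. \<not> on_odd c i} = evens - {q}"
    using q by (auto simp: surplus_configs_def)
  then show "card (guards c) = K"
    using card_guards[of c] q K ev finite_evens by (simp add: surplus_configs_def)
qed (rule shift_closed_many_even_configs[OF ev])

end

subsection \<open>Lower bounds\<close>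

context melon
begin

lemma vertex_cover_edgeD:
  assumes "vertex_cover verts edges U" "i \<in> I" "j < len i"
  shows "x i j \<in> U \<or> x i (Suc j) \<in> U"
  using assms(1) edgeI[OF assms(2,3)] by (auto simp: vertex_cover_def)

lemma card_cover_segment:
  assumes U: "vertex_cover verts edges U" and i: "i \<in> I"
  shows "a + m \<le> Suc (len i) \<Longrightarrow> m div 2 \<le> card (U \<inter> x i ` {a..<a + m})"
proof (induction m rule: induct_nat_012)
  case (ge2 m)
  obtain j where j: "j = a + m \<or> j = Suc (a + m)" "x i j \<in> U"
    using vertex_cover_edgeD[OF U i, of "a + m"] ge2.prems by auto
  have "inj_on (x i) {a..<a + Suc (Suc m)}"
    by (rule inj_on_subset[OF inj_on_path[OF i]]) (use ge2.prems in auto)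
  then have "x i j \<notin> x i ` {a..<a + m}"
    using j(1) inj_on_image_mem_iff[of "x i" "{a..<a + Suc (Suc m)}" j "{a..<a + m}"] by auto
  then have "Suc (Suc m) div 2 \<le> card (insert (x i j) (U \<inter> x i ` {a..<a + m}))"
    using ge2 by simp
  also have "\<dots> \<le> card (U \<inter> x i ` {a..<a + Suc (Suc m)})"
    by (rule card_mono) (use j in auto)
  finally show ?case .
qed simp_all

lemma card_cover_inner_segment:
  assumes U: "vertex_cover verts edges U" and i: "i \<in> I" and a: "0 < a" "a + m \<le> len i"
    and J: "J \<subseteq> {0<..<len i}" "J \<inter> {a..<a + m} = {}" "x i ` J \<subseteq> U"
  shows "m div 2 + card J \<le> card (U \<inter> inner i)"
proof -
  have inj: "inj_on (x i) {0<..<len i}"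
    by (rule inj_on_subset[OF inj_on_path[OF i]]) auto
  have "x i ` {a..<a + m} \<inter> x i ` J = {}"
    by (subst inj_on_image_Int[OF inj, symmetric]) (use a J in auto)
  then have "card (U \<inter> x i ` {a..<a + m}) + card (x i ` J) =
      card ((U \<inter> x i ` {a..<a + m}) \<union> x i ` J)"
    using finite_subset[OF J(1)] by (intro card_Un_disjoint[symmetric]) auto
  also have "\<dots> \<le> card (U \<inter> inner i)"
    using J a by (intro card_mono) (auto simp: inner_def)
  finally show ?thesis
    using card_cover_segment[OF U i, of a m] a card_image[OF inj_on_subset[OF inj J(1)]] by simp
qed

lemma card_cover_inner:
  assumes "vertex_cover verts edges U" "i \<in> I"
  shows "(len i - 1) div 2 \<le> card (U \<inter> inner i)"
  using card_cover_inner_segment[OF assms, of 1 "len i - 1" "{}"] len_pos[OF assms(2)] by simp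

lemma card_cover_inner_neighbour:
  assumes "vertex_cover verts edges U" "i \<in> I" "x i 1 \<in> U \<or> x i (len i - 1) \<in> U"
  shows "len i div 2 \<le> card (U \<inter> inner i)"
proof (cases "len i = 1")
  case False
  then have "2 \<le> len i" using len_pos[OF assms(2)] by simp
  then obtain l where len: "len i = 2 + l" using le_Suc_ex by blast
  from assms(3) show ?thesis
  proof
    assume "x i 1 \<in> U"
    then show ?thesis
      using card_cover_inner_segment[OF assms(1,2), of 2 l "{1}"] len by simp
  next
    assume "x i (len i - 1) \<in> U"
    then show ?thesis
      using card_cover_inner_segment[OF assms(1,2), of 1 l "{Suc l}"] len by simp
  qed
qed simp

lemma vertex_cover_neighbour_of_missing_end:
  assumes "vertex_cover verts edges U" "i \<in> I"
  shows "s \<notin> U \<Longrightarrow> x i 1 \<in> U" and "t \<notin> U \<Longrightarrow> x i (len i - 1) \<in> U"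
  using vertex_cover_edgeD[OF assms, of 0] vertex_cover_edgeD[OF assms, of "len i - 1"]
    len_pos[OF assms(2)] x_0[OF assms(2)] x_len[OF assms(2)] by auto

lemma card_cover_inner_no_end:
  assumes U: "vertex_cover verts edges U" and i: "i \<in> I" and "s \<notin> U" "t \<notin> U"
  shows "(len i + 1) div 2 \<le> card (U \<inter> inner i)"
proof -
  have first: "x i 1 \<in> U" and last: "x i (len i - 1) \<in> U"
    using vertex_cover_neighbour_of_missing_end[OF U i] assms(3,4) by simp_all
  consider "len i = 1" | "len i = 2" | "3 \<le> len i" using len_pos[OF i] by linarith
  then show ?thesis
  proof cases
    assume "len i = 1"
    then show ?thesis using first x_len[OF i] \<open>t \<notin> U\<close> by simp
  next
    assume "len i = 2"
    then show ?thesis using card_cover_inner_neighbour[OF U i] first by simp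
  next
    assume "3 \<le> len i"
    then obtain l where len: "len i = 3 + l" using le_Suc_ex by blast
    then show ?thesis
      using card_cover_inner_segment[OF U i, of 2 l "{1, len i - 1}"] first last by simp
  qed
qed

lemma sum_half_pred_len: "2 * (\<Sum>i\<in>I. (len i - 1) div 2) + card evens + 2 = card verts"
proof -
  have "2 * ((len i - 1) div 2) + of_bool (even (len i)) = len i - 1" if "i \<in> I" for i
    using len_pos[OF that] by (cases "even (len i)") (auto elim!: evenE oddE)
  then have "(\<Sum>i\<in>I. 2 * ((len i - 1) div 2) + of_bool (even (len i))) = (\<Sum>i\<in>I. len i - 1)"
    by (rule sum.cong[OF refl])
  then show ?thesis
    unfolding sum.distrib sum_of_bool_even_len sum_distrib_left[symmetric] card_verts by simp
qed

lemma sum_half_len: "2 * (\<Sum>i\<in>I. len i div 2) + 2 = card verts + card evens"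
proof -
  have "2 * (len i div 2) = len i - 1 + of_bool (even (len i))" if "i \<in> I" for i
    using len_pos[OF that] by (cases "even (len i)") (auto elim!: evenE oddE)
  then have "(\<Sum>i\<in>I. 2 * (len i div 2)) = (\<Sum>i\<in>I. len i - 1 + of_bool (even (len i)))"
    by (rule sum.cong[OF refl])
  then show ?thesis
    unfolding sum.distrib sum_of_bool_even_len sum_distrib_left[symmetric] card_verts by simp
qed

lemma sum_half_Suc_len: "2 * (\<Sum>i\<in>I. (len i + 1) div 2) + card evens + 2 = card verts + 2 * card I"
proof -
  have "2 * ((len i + 1) div 2) + of_bool (even (len i)) = len i - 1 + 2" if "i \<in> I" for i
    using len_pos[OF that] by (cases "even (len i)") (auto elim!: evenE oddE)
  then have "(\<Sum>i\<in>I. 2 * ((len i + 1) div 2) + of_bool (even (len i))) = (\<Sum>i\<in>I. len i - 1 + 2)"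
    by (rule sum.cong[OF refl])
  then show ?thesis
    unfolding sum.distrib sum_of_bool_even_len sum_distrib_left[symmetric] card_verts by simp
qed

lemma card_vertex_cover:
  assumes "vertex_cover verts edges U"
  shows "card U = of_bool (s \<in> U) + of_bool (t \<in> U) + (\<Sum>i\<in>I. card (U \<inter> inner i))"
  using assms card_subset_verts by (simp add: vertex_cover_def)

lemma card_cover_both_ends:
  assumes U: "vertex_cover verts edges U" and "s \<in> U" "t \<in> U"
  shows "card verts + 2 \<le> 2 * card U + card evens"
proof -
  have "(\<Sum>i\<in>I. (len i - 1) div 2) \<le> (\<Sum>i\<in>I. card (U \<inter> inner i))"
    by (rule sum_mono[OF card_cover_inner[OF U]])
  then show ?thesis using sum_half_pred_len card_vertex_cover[OF U] assms(2,3) by simp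
qed

lemma card_cover_both_ends_neighbour:
  assumes U: "vertex_cover verts edges U" and "s \<in> U" "t \<in> U" "i \<in> evens" "x i 1 \<in> U"
  shows "card verts + 4 \<le> 2 * card U + card evens"
proof -
  have "(\<Sum>i\<in>I. (len i - 1) div 2) < (\<Sum>i\<in>I. card (U \<inter> inner i))"
  proof (rule sum_strict_mono_ex1[OF finite_I])
    have i: "i \<in> I" "even (len i)" using assms(4) by (simp_all add: evens_iff)
    then have "(len i - 1) div 2 < len i div 2" using len_pos[of i] by (auto elim!: evenE)
    then show "\<exists>i\<in>I. (len i - 1) div 2 < card (U \<inter> inner i)"
      using card_cover_inner_neighbour[OF U i(1)] assms(5) i(1) by (intro bexI[of _ i]) auto
  qed (use card_cover_inner[OF U] in blast)
  then show ?thesis using sum_half_pred_len card_vertex_cover[OF U] assms(2,3) by simp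
qed

lemma card_cover_one_end:
  assumes U: "vertex_cover verts edges U" and "(s \<in> U) \<noteq> (t \<in> U)"
  shows "card verts + card evens \<le> 2 * card U"
proof -
  have "len i div 2 \<le> card (U \<inter> inner i)" if "i \<in> I" for i
    using card_cover_inner_neighbour[OF U that] vertex_cover_neighbour_of_missing_end[OF U that]
      assms(2) by blast
  then have "(\<Sum>i\<in>I. len i div 2) \<le> (\<Sum>i\<in>I. card (U \<inter> inner i))" by (rule sum_mono)
  then show ?thesis using sum_half_len card_vertex_cover[OF U] assms(2) by (cases "s \<in> U") simp_all
qed

lemma card_cover_no_end:
  assumes U: "vertex_cover verts edges U" and "s \<notin> U" "t \<notin> U"
  shows "card verts + 2 * card I \<le> 2 * card U + card evens + 2"
proof -
  have "(\<Sum>i\<in>I. (len i + 1) div 2) \<le> (\<Sum>i\<in>I. card (U \<inter> inner i))"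
    by (rule sum_mono[OF card_cover_inner_no_end[OF U _ assms(2,3)]])
  then show ?thesis using sum_half_Suc_len card_vertex_cover[OF U] assms(2,3) by simp
qed

subsection \<open>The eternal vertex cover number of a melon\<close>

lemma even_card_verts_evens: "even (card verts + card evens)"
proof -
  have "card verts + card evens = 2 * card (guards (Config True False (\<lambda>_. True)))"
    using card_guards[of "Config True False (\<lambda>_. True)"] by simp
  then show ?thesis by (metis dvd_triv_left)
qed

lemma evc_class_ge_half:
  assumes "2 \<le> card I" "card evens \<le> 2" and cls: "evc_class verts edges \<U> K"
  shows "card verts \<le> 2 * K"
proof -
  obtain U where "U \<in> \<U>" by (rule evc_class_nonempty[OF cls])
  then have U: "vertex_cover verts edges U" "card U = K" using evc_class_memberD[OF cls] by simp_all
  show ?thesis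
    using card_cover_both_ends[OF U(1)] card_cover_one_end[OF U(1)] card_cover_no_end[OF U(1)]
      assms(1,2) U(2) by (cases "s \<in> U"; cases "t \<in> U") auto
qed

lemma evc_few_even:
  assumes k: "2 \<le> card I" and ev: "card evens \<le> 1"
  shows "2 * evc verts edges = card verts + card evens"
proof -
  obtain K where K: "card verts + card evens = 2 * K" using even_card_verts_evens by (rule evenE)
  have "K \<le> k'" if "evc_class verts edges \<U> k'" for \<U> k'
    using evc_class_ge_half[OF k _ that] ev K by linarith
  moreover consider "evens = {}" | q where "evens = {q}"
    using ev finite_evens by (metis One_nat_def card_0_eq card_1_singletonE le_Suc_eq le_zero_eq)
  then have "\<exists>\<U>. evc_class verts edges \<U> K"
    by cases (use evc_class_no_even[OF k] evc_class_one_even[OF k] K in auto)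
  ultimately have "evc verts edges = K" by (blast intro: evc_eqI)
  then show ?thesis using K by simp
qed

lemma evc_two_paths:
  assumes k: "card I = 2"
  shows "evc verts edges = (card verts + 1) div 2"
proof (cases "card evens \<le> 1")
  case True
  then show ?thesis using evc_few_even k by (cases "card evens") auto
next
  case False
  then have ev: "evens = I" using card_seteq[OF finite_I evens_subset] k by simp
  then have "even (card verts)" using even_card_verts_evens k by simp
  then obtain K where K: "2 * K = card verts" by (metis evenE)
  have "K \<le> k'" if "evc_class verts edges \<U> k'" for \<U> k'
    using evc_class_ge_half[OF _ _ that] ev k K by simp
  then have "evc verts edges = K" using evc_eqI[OF evc_class_two_even[OF k ev K]] by blast
  then show ?thesis using K by simp
qed

text \<open>
  Below the claimed size every cover of the class contains \<open>s\<close> and no neighbour of \<open>s\<close> on an even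
  path, so it cannot answer the attack on an edge between the two.
\<close>

lemma evc_class_many_even_ge:
  assumes k: "3 \<le> card I" and ev: "2 \<le> card evens" and cls: "evc_class verts edges \<U> K"
  shows "card verts + 4 \<le> 2 * K + card evens"
proof (rule ccontr)
  assume "\<not> ?thesis"
  moreover obtain h where "card verts + card evens = 2 * h"
    using even_card_verts_evens by (rule evenE)
  ultimately have small: "2 * K + card evens \<le> card verts + 2" by presburger
  have member: "s \<in> U \<and> (\<forall>i\<in>evens. x i 1 \<notin> U)" if "U \<in> \<U>" for U
  proof -
    have U: "vertex_cover verts edges U" "card U = K" by (fact evc_class_memberD[OF cls that])+
    then have "s \<in> U \<and> t \<in> U"
      using card_cover_one_end[OF U(1)] card_cover_no_end[OF U(1)] small k ev by linarith
    then show ?thesis using card_cover_both_ends_neighbour[OF U(1)] U(2) small by fastforce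
  qed
  obtain U where U: "U \<in> \<U>" by (rule evc_class_nonempty[OF cls])
  obtain i where i: "i \<in> evens" using card_ge_two_obtain_other[OF ev] by blast
  then have "{s, x i 1} \<in> edges"
    using x_0[of i] len_pos[of i] edgeI[of i 0] by (simp add: evens_iff)
  then obtain \<phi> where \<phi>: "defense verts edges U s (x i 1) \<phi>" "\<phi> ` U \<in> \<U>"
    using evc_class_defenseE[OF cls U] by blast
  then have "\<phi> s = x i 1" using member[OF U] i by (simp add: defense_def)
  then have "x i 1 \<in> \<phi> ` U" using member[OF U] by (metis imageI)
  then show False using member[OF \<phi>(2)] i by blast
qed

lemma evc_many_even:
  assumes k: "3 \<le> card I" and ev: "2 \<le> card evens"
  shows "2 * evc verts edges + card evens = card verts + 4"
proof -
  obtain h where "card verts + card evens = 2 * h" using even_card_verts_evens by (rule evenE)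
  moreover have "card evens \<le> card verts + 2"
    using card_guards[of "Config False False (\<lambda>_. False)"] by simp
  ultimately have "2 * (h + 2 - card evens) + card evens = card verts + 4" by linarith
  then obtain K where K: "2 * K + card evens = card verts + 4" by blast
  have "K \<le> k'" if "evc_class verts edges \<U> k'" for \<U> k'
    using evc_class_many_even_ge[OF k ev that] K by simp
  then have "evc verts edges = K" using evc_eqI[OF evc_class_many_even[OF ev K]] by blast
  then show ?thesis using K by simp
qed

lemma closed_nbhd_single_path:
  assumes I: "I = {i}" and w: "w \<in> closed_nbhd verts edges (x i a)" and a: "a < len i"
  shows "w \<in> x i ` {..Suc a}"
proof (cases "w = x i a")
  case False
  then have "{x i a, w} \<in> edges" using w by (simp add: closed_nbhd_def)
  then show ?thesis
  proof (cases rule: edge_cases)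
    case (forward i' j)
    then show ?thesis using I a x_eq_iff[of i a i j] by auto
  next
    case (backward i' j)
    then show ?thesis using I a x_eq_iff[of i a i "Suc j"] by auto
  qed
qed auto

lemma defense_extends_prefix:
  assumes I: "I = {i}" and p: "p < len i" and \<phi>: "defense verts edges U (x i p) (x i (Suc p)) \<phi>"
    and prefix: "x i ` {..<p} \<subseteq> U" and "x i p \<notin> U"
  shows "x i ` {..p} \<subseteq> \<phi> ` U"
proof -
  let ?Q = "x i ` insert (Suc p) {..<p}"
  have i: "i \<in> I" using I by simp
  have next_guard: "x i (Suc p) \<in> U" "\<phi> (x i (Suc p)) = x i p"
    using \<phi> \<open>x i p \<notin> U\<close> by (auto simp: defense_def)
  then have Q: "?Q \<subseteq> U" using prefix by auto
  have "\<phi> (x i a) \<in> x i ` {..p}" if "a < p" for a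
  proof -
    have "\<phi> (x i a) \<in> closed_nbhd verts edges (x i a)"
      using \<phi> prefix that by (auto simp: defense_def)
    then have "\<phi> (x i a) \<in> x i ` {..Suc a}"
      by (rule closed_nbhd_single_path[OF I]) (use that p in simp)
    moreover have "x i ` {..Suc a} \<subseteq> x i ` {..p}" using that by (intro image_mono) auto
    ultimately show ?thesis by (rule rev_subsetD)
  qed
  then have "\<phi> ` ?Q \<subseteq> x i ` {..p}" using next_guard(2) by auto
  moreover have "card (\<phi> ` ?Q) = card (x i ` {..p})"
  proof -
    have "inj_on \<phi> U" using \<phi> by (simp add: defense_def)
    then have "inj_on \<phi> ?Q" using Q by (rule inj_on_subset)
    moreover have "inj_on (x i) (insert (Suc p) {..<p})" "inj_on (x i) {..p}"
      by (rule inj_on_subset[OF inj_on_path[OF i]]; use p in auto)+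
    ultimately show ?thesis by (simp add: card_image)
  qed
  ultimately have "\<phi> ` ?Q = x i ` {..p}" by (intro card_subset_eq) auto
  then show ?thesis using Q by blast
qed

lemma evc_class_contains_prefix:
  assumes I: "I = {i}" and cls: "evc_class verts edges \<U> k"
  shows "p \<le> len i \<Longrightarrow> \<exists>U\<in>\<U>. x i ` {..<p} \<subseteq> U"
proof (induction p)
  case 0
  obtain U where "U \<in> \<U>" by (rule evc_class_nonempty[OF cls])
  then show ?case by auto
next
  case (Suc p)
  then obtain U where U: "U \<in> \<U>" "x i ` {..<p} \<subseteq> U" by auto
  show ?case
  proof (cases "x i p \<in> U")
    case True
    then show ?thesis using U by (intro bexI[of _ U]) (auto simp: lessThan_Suc)
  next
    case False
    have "{x i p, x i (Suc p)} \<in> edges" using I Suc.prems edgeI[of i p] by simp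
    then obtain \<phi> where \<phi>: "defense verts edges U (x i p) (x i (Suc p)) \<phi>" "\<phi> ` U \<in> \<U>"
      using evc_class_defenseE[OF cls U(1)] by blast
    then have "x i ` {..p} \<subseteq> \<phi> ` U"
      using defense_extends_prefix[OF I _ \<phi>(1) U(2) False] Suc.prems by simp
    then show ?thesis using \<phi>(2) by (auto simp: lessThan_Suc_atMost)
  qed
qed

lemma evc_single_path:
  assumes "card I = 1"
  shows "evc verts edges = card verts - 1"
proof (rule evc_eqI)
  have "verts \<noteq> {}" using s_in_verts by blast
  then show "evc_class verts edges {verts - {z} |z. z \<in> verts} (card verts - 1)"
    by (rule evc_class_all_but_one[OF simple_graph_melon])
next
  fix \<U> k assume cls: "evc_class verts edges \<U> k"
  obtain i where I: "I = {i}" using assms card_1_singletonE by blast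
  then have i: "i \<in> I" by simp
  obtain U where U: "U \<in> \<U>" "x i ` {..<len i} \<subseteq> U"
    using evc_class_contains_prefix[OF I cls] by blast
  note member = evc_class_memberD[OF cls U(1)]
  have "card (x i ` {..<len i}) = len i"
    by (subst card_image[OF inj_on_subset[OF inj_on_path[OF i]]]) auto
  moreover have "finite U"
    using member(1) finite_subset[OF _ finite_verts] by (simp add: vertex_cover_def)
  ultimately have "len i \<le> k" using card_mono[OF _ U(2)] member(2) by simp
  then show "card verts - 1 \<le> k" using card_verts I len_pos[OF i] by simp
qed

end

definition melon_evc :: "nat \<Rightarrow> nat \<Rightarrow> nat \<Rightarrow> nat" where
  "melon_evc n k e =
     (if k = 1 then n - 1
      else ((if k = 2 then n else if e \<le> 1 then n + e else n + 4 - e) + 1) div 2)"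

theorem (in melon) evc_eq_melon_evc:
  "evc verts edges = melon_evc (card verts) (card I) (card evens)"
proof -
  have "0 < card I" using finite_I I_nonempty by (simp add: card_gt_0_iff)
  then consider "card I = 1" | "card I = 2" | "3 \<le> card I" by linarith
  then show ?thesis
  proof cases
    assume "3 \<le> card I"
    then show ?thesis
      using evc_few_even evc_many_even by (cases "card evens \<le> 1") (simp_all add: melon_evc_def)
  qed (simp_all add: melon_evc_def evc_single_path evc_two_paths)
qed

subsection \<open>Reversing the paths\<close>

context melon
begin

lemma melon_mirror: "melon I len (\<lambda>i j. x i (len i - j)) t s"
proof
  fix i i' j j'
  assume "i \<in> I" "i' \<in> I" "0 < j" "j < len i" "0 < j'" "j' < len i'"
    "x i (len i - j) = x i' (len i' - j')"
  then show "i = i' \<and> j = j'" using x_inj[of i i' "len i - j" "len i' - j'"] by auto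
qed (use finite_I I_nonempty s_neq_t len_pos x_0 x_len x_inner in auto)

lemma verts_mirror: "melon.verts I len (\<lambda>i j. x i (len i - j)) t s = verts"
proof -
  interpret mirror: melon I len "\<lambda>i j. x i (len i - j)" t s by (rule melon_mirror)
  have "(\<lambda>j. n - j) ` {0<..<n} = {0<..<n}" for n :: nat
  proof (intro equalityI subsetI)
    fix j assume "j \<in> {0<..<n}"
    then show "j \<in> (\<lambda>j. n - j) ` {0<..<n}" by (intro image_eqI[of _ _ "n - j"]) auto
  qed auto
  then have "mirror.inner i = inner i" for i
    unfolding mirror.inner_def inner_def by (metis image_image)
  then show ?thesis by (auto simp: mirror.verts_def verts_def)
qed

lemma edges_mirror: "melon.edges I len (\<lambda>i j. x i (len i - j)) = edges"
proof -
  interpret mirror: melon I len "\<lambda>i j. x i (len i - j)" t s by (rule melon_mirror)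
  show ?thesis
  proof (intro equalityI subsetI)
    fix e assume "e \<in> mirror.edges"
    then obtain i j where ij: "i \<in> I" "j < len i" "e = {x i (len i - j), x i (len i - Suc j)}"
      by (auto simp: mirror.edges_def)
    then show "e \<in> edges"
      using edgeI[of i "len i - Suc j"] by (simp add: Suc_diff_Suc insert_commute)
  next
    fix e assume "e \<in> edges"
    then obtain i j where ij: "i \<in> I" "j < len i" "e = {x i j, x i (Suc j)}"
      by (auto simp: edges_def)
    then show "e \<in> mirror.edges"
      using mirror.edgeI[of i "len i - Suc j"] by (simp add: Suc_diff_Suc insert_commute)
  qed
qed

end

subsection \<open>Degrees, and melons without parallel edges\<close>

definition degree :: "'a set set \<Rightarrow> 'a \<Rightarrow> nat" where
  "degree E v = card {w. {v, w} \<in> E}"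

context melon
begin

lemma neighbours_s: "{v. {s, v} \<in> edges} = (\<lambda>i. x i 1) ` I"
proof (intro equalityI subsetI)
  fix v assume "v \<in> {v. {s, v} \<in> edges}"
  then have "{s, v} \<in> edges" by simp
  then show "v \<in> (\<lambda>i. x i 1) ` I"
  proof (cases rule: edge_cases)
    case (forward i j)
    then have "j = 0" using x_eq_s_iff[of i j] by simp
    then show ?thesis using forward by auto
  next
    case (backward i j)
    then show ?thesis using x_eq_s_iff[of i "Suc j"] by simp
  qed
next
  fix v assume "v \<in> (\<lambda>i. x i 1) ` I"
  then show "v \<in> {v. {s, v} \<in> edges}" using edgeI[of _ 0] len_pos x_0 by auto
qed

lemma neighbours_inner:
  assumes "i \<in> I" "0 < j" "j < len i"
  shows "{v. {x i j, v} \<in> edges} = {x i (j - 1), x i (Suc j)}"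
proof (intro equalityI subsetI)
  fix v assume "v \<in> {v. {x i j, v} \<in> edges}"
  then have "{x i j, v} \<in> edges" by simp
  then show "v \<in> {x i (j - 1), x i (Suc j)}"
  proof (cases rule: edge_cases)
    case (forward i' j')
    then show ?thesis using assms x_eq_iff[of i j i' j'] by auto
  next
    case (backward i' j')
    then show ?thesis using assms x_eq_iff[of i j i' "Suc j'"] by auto
  qed
next
  fix v assume "v \<in> {x i (j - 1), x i (Suc j)}"
  then show "v \<in> {v. {x i j, v} \<in> edges}"
    using edgeI[of i "j - 1"] edgeI[of i j] assms by (auto simp: insert_commute)
qed

lemma path_neighbours_neq:
  assumes "i \<in> I" "0 < j" "j < len i"
  shows "x i (j - 1) \<noteq> x i (Suc j)"
  using assms x_eq_iff[of i "j - 1" i "Suc j"] by auto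

lemma degree_inner:
  assumes "i \<in> I" "0 < j" "j < len i"
  shows "degree edges (x i j) = 2"
  using path_neighbours_neq[OF assms] by (simp add: degree_def neighbours_inner[OF assms])

lemma degree_not_end: "v \<in> verts \<Longrightarrow> v \<noteq> s \<Longrightarrow> v \<noteq> t \<Longrightarrow> degree edges v = 2"
  using degree_inner by (auto simp: verts_def inner_def)

lemma sum_len: "(\<Sum>i\<in>I. len i) + 2 = card verts + card I"
proof -
  have "(\<Sum>i\<in>I. len i) = (\<Sum>i\<in>I. (len i - 1) + 1)"
    by (rule sum.cong) (use len_pos in force)+
  then show ?thesis by (simp add: sum_Suc card_verts)
qed

end

locale simple_melon = melon +
  assumes one_short: "i \<in> I \<Longrightarrow> i' \<in> I \<Longrightarrow> len i = 1 \<Longrightarrow> len i' = 1 \<Longrightarrow> i = i'"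
begin

lemma simple_melon_mirror: "simple_melon I len (\<lambda>i j. x i (len i - j)) t s"
  by (intro simple_melon.intro melon_mirror) (unfold_locales, rule one_short)

lemma inj_on_first: "inj_on (\<lambda>i. x i 1) I"
proof (rule inj_onI)
  fix i i' assume i: "i \<in> I" "i' \<in> I" and "x i 1 = x i' 1"
  then have "1 = len i \<and> 1 = len i' \<or> i = i'"
    using x_eq_iff[of i 1 i' 1] len_pos[of i] len_pos[of i'] by simp
  then show "i = i'" using one_short[OF i] by auto
qed

lemma degree_s: "degree edges s = card I"
  using card_image[OF inj_on_first] by (simp add: degree_def neighbours_s)

lemma degree_t: "degree edges t = card I"
proof -
  interpret mirror: simple_melon I len "\<lambda>i j. x i (len i - j)" t s by (rule simple_melon_mirror)
  show ?thesis using mirror.degree_s by (simp add: edges_mirror)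
qed

lemma sum_degrees: "(\<Sum>v\<in>verts. degree edges v) + 4 = 2 * card I + 2 * card verts"
proof -
  have ends: "{s, t} \<subseteq> verts" using s_in_verts t_in_verts by simp
  have "(\<Sum>v\<in>verts. degree edges v) =
      (\<Sum>v\<in>verts - {s, t}. degree edges v) + (\<Sum>v\<in>{s, t}. degree edges v)"
    by (rule sum.subset_diff[OF ends finite_verts])
  also have "(\<Sum>v\<in>verts - {s, t}. degree edges v) = 2 * (card verts - 2)"
    using s_neq_t ends by (simp add: degree_not_end card_Diff_subset)
  also have "(\<Sum>v\<in>{s, t}. degree edges v) = 2 * card I"
    using s_neq_t by (simp add: degree_s degree_t)
  finally show ?thesis using card_verts by simp
qed

lemma card_I_less: "card I < card verts"
proof -
  have "card I = (\<Sum>i\<in>I. 1)" by simp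
  also have "\<dots> \<le> (\<Sum>i\<in>I. of_bool (len i = 1) + (len i - 1))"
    by (rule sum_mono) (use len_pos in force)
  also have "\<dots> = card {i \<in> I. len i = 1} + (\<Sum>i\<in>I. len i - 1)"
    using finite_I by (simp add: sum.distrib Int_def)
  also have "card {i \<in> I. len i = 1} \<le> Suc 0"
    using finite_I one_short by (subst card_le_Suc0_iff_eq) auto
  finally show ?thesis by (simp add: card_verts)
qed

end

definition melon_paths :: "'a \<Rightarrow> 'a \<Rightarrow> 'a list set \<Rightarrow> bool" where
  "melon_paths s t Ps \<longleftrightarrow> finite Ps \<and> Ps \<noteq> {} \<and> s \<noteq> t \<and>
     (\<forall>xs\<in>Ps. distinct xs \<and> 2 \<le> length xs \<and> hd xs = s \<and> last xs = t) \<and>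
     (\<forall>xs\<in>Ps. \<forall>ys\<in>Ps. xs \<noteq> ys \<longrightarrow> set xs \<inter> set ys = {s, t})"

text \<open>
  Repeated paths of length one, which \<^const>\<open>k_melon_graph\<close> admits, collapse in the set of paths.
\<close>

lemma melon_graph_paths:
  assumes "melon_graph V E"
  obtains s t Ps where "melon_paths s t Ps" "V = (\<Union>xs\<in>Ps. set xs)" "E = (\<Union>xs\<in>Ps. path_edges xs)"
proof -
  obtain k where "1 \<le> k" "k_melon_graph k V E" using assms by (auto simp: melon_graph_def)
  then obtain s t P where "s \<noteq> t"
    and P: "\<forall>i<k. distinct (P i) \<and> 2 \<le> length (P i) \<and> hd (P i) = s \<and> last (P i) = t"
    and disjoint: "\<forall>i<k. \<forall>j<k. i \<noteq> j \<longrightarrow> set (P i) \<inter> set (P j) = {s, t}"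
    and VE: "V = (\<Union>i<k. set (P i))" "E = (\<Union>i<k. path_edges (P i))"
    unfolding k_melon_graph_def by (elim exE conjE)
  have "set (P i) \<inter> set (P j) = {s, t}" if "i < k" "j < k" "P i \<noteq> P j" for i j
    using disjoint that by metis
  then have "melon_paths s t (P ` {..<k})"
    using \<open>1 \<le> k\<close> \<open>s \<noteq> t\<close> P unfolding melon_paths_def by (auto simp: lessThan_empty_iff)
  then show ?thesis using that VE by blast
qed

lemma melon_paths_nth:
  assumes "melon_paths s t Ps" "xs \<in> Ps"
  shows "xs ! 0 = s" "xs ! (length xs - 1) = t"
    and "j < length xs \<Longrightarrow> j' < length xs \<Longrightarrow> xs ! j = xs ! j' \<longleftrightarrow> j = j'"
proof -
  have xs: "xs \<noteq> []" "distinct xs" "hd xs = s" "last xs = t"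
    using assms by (auto simp: melon_paths_def)
  then show "xs ! 0 = s" "xs ! (length xs - 1) = t" by (simp_all add: hd_conv_nth last_conv_nth)
  show "xs ! j = xs ! j' \<longleftrightarrow> j = j'" if "j < length xs" "j' < length xs"
    using xs(2) that by (simp add: nth_eq_iff_index_eq)
qed

lemma melon_paths_nth_inner:
  assumes "melon_paths s t Ps" "xs \<in> Ps" "0 < j" "j < length xs - 1"
  shows "xs ! j \<noteq> s \<and> xs ! j \<noteq> t"
proof -
  have "0 < length xs" "j < length xs" "length xs - 1 < length xs" using assms(4) by linarith+
  then show ?thesis
    using melon_paths_nth(1,2)[OF assms(1,2)] melon_paths_nth(3)[OF assms(1,2)] assms(3,4)
    by (metis less_not_refl)
qed

lemma simple_melon_of_paths:
  assumes Ps: "melon_paths s t Ps"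
  shows "simple_melon Ps (\<lambda>xs. length xs - 1) (!) s t"
proof
  show "finite Ps" "Ps \<noteq> {}" "s \<noteq> t" using Ps by (simp_all add: melon_paths_def)
next
  fix xs assume xs: "xs \<in> Ps"
  then show "0 < length xs - 1" using Ps by (force simp: melon_paths_def)
  show "xs ! 0 = s" "xs ! (length xs - 1) = t" by (rule melon_paths_nth[OF Ps xs])+
next
  fix xs j assume "xs \<in> Ps" "0 < j" "j < length xs - 1"
  then show "xs ! j \<noteq> s \<and> xs ! j \<noteq> t" by (rule melon_paths_nth_inner[OF Ps])
next
  fix xs ys j j'
  assume xs: "xs \<in> Ps" "0 < j" "j < length xs - 1" and ys: "ys \<in> Ps" "0 < j'" "j' < length ys - 1"
    and eq: "xs ! j = ys ! j'"
  have "xs = ys"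
  proof (rule ccontr)
    assume "xs \<noteq> ys"
    then have "set xs \<inter> set ys = {s, t}" using Ps xs(1) ys(1) by (simp add: melon_paths_def)
    moreover have "xs ! j \<in> set xs \<inter> set ys"
      using xs ys eq by (metis IntI less_diff_conv nth_mem add_lessD1)
    ultimately show False using melon_paths_nth_inner[OF Ps xs] by auto
  qed
  then show "xs = ys \<and> j = j'" using melon_paths_nth(3)[OF Ps xs(1), of j j'] xs ys eq by simp
next
  fix xs ys assume "xs \<in> Ps" "ys \<in> Ps" "length xs - 1 = 1" "length ys - 1 = 1"
  moreover have "zs = [s, t]" if "zs \<in> Ps" "length zs - 1 = 1" for zs
  proof -
    have "length zs = 2" "hd zs = s" "last zs = t" using that Ps by (auto simp: melon_paths_def)
    then show ?thesis by (cases zs; cases "tl zs") auto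
  qed
  ultimately show "xs = ys" by metis
qed

lemma verts_of_paths:
  assumes Ps: "melon_paths s t Ps"
  shows "melon.verts Ps (\<lambda>xs. length xs - 1) (!) s t = (\<Union>xs\<in>Ps. set xs)"
proof -
  interpret simple_melon Ps "\<lambda>xs. length xs - 1" "(!)" s t by (rule simple_melon_of_paths[OF Ps])
  have "set xs = {s, t} \<union> inner xs" if xs: "xs \<in> Ps" for xs
  proof -
    have "set xs = (!) xs ` {..length xs - 1}"
      using len_pos[OF xs] by (auto simp: set_conv_nth image_iff less_eq_Suc_le)
    also have "{..length xs - 1} = insert 0 (insert (length xs - 1) {0<..<length xs - 1})" by auto
    finally show ?thesis using x_0[OF xs] x_len[OF xs] unfolding inner_def by simp
  qed
  then show ?thesis using I_nonempty unfolding verts_def by auto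
qed

lemma edges_of_paths:
  assumes Ps: "melon_paths s t Ps"
  shows "melon.edges Ps (\<lambda>xs. length xs - 1) (!) = (\<Union>xs\<in>Ps. path_edges xs)"
proof -
  interpret simple_melon Ps "\<lambda>xs. length xs - 1" "(!)" s t by (rule simple_melon_of_paths[OF Ps])
  show ?thesis unfolding edges_def path_edges_def by (auto simp: less_diff_conv)
qed

subsection \<open>Graphs stored in memory\<close>

definition mem_degree :: "(nat \<Rightarrow> nat) \<Rightarrow> nat \<Rightarrow> nat" where
  "mem_degree h u = h (u + 2) - h (u + 1)"

definition mem_nbr :: "(nat \<Rightarrow> nat) \<Rightarrow> nat \<Rightarrow> nat \<Rightarrow> nat" where
  "mem_nbr h u i = h (h (u + 1) + i)"

definition list_start :: "nat list list \<Rightarrow> nat \<Rightarrow> nat" where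
  "list_start adj i = length adj + 2 + length (concat (take i adj))"

lemma list_start_Suc:
  "i < length adj \<Longrightarrow> list_start adj (Suc i) = list_start adj i + length (adj ! i)"
  by (simp add: list_start_def take_Suc_conv_app_nth)

lemma list_start_length: "list_start adj (length adj) = length adj + 2 + length (concat adj)"
  by (simp add: list_start_def)

lemma list_start_le: "list_start adj i \<le> length adj + 2 + length (concat adj)"
proof -
  have "length (concat (take i adj)) \<le> length (concat (take i adj) @ concat (drop i adj))" by simp
  then show ?thesis by (simp add: list_start_def flip: concat_append)
qed

lemma concat_nth:
  assumes "i < length xss" "j < length (xss ! i)"
  shows "length (concat (take i xss)) + j < length (concat xss)"
    and "concat xss ! (length (concat (take i xss)) + j) = xss ! i ! j"
proof -
  have "concat xss = concat (take i xss) @ xss ! i @ concat (drop (Suc i) xss)"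
    using arg_cong[OF id_take_nth_drop[OF assms(1)], of concat] by simp
  then show "length (concat (take i xss)) + j < length (concat xss)"
    and "concat xss ! (length (concat (take i xss)) + j) = xss ! i ! j"
    using assms(2) by (simp_all add: nth_append)
qed

lemma length_encoding: "length (encoding adj) = length adj + 2 + length (concat adj)"
  by (simp add: encoding_def)

lemma input_memory:
  assumes "h = snd (input_state adj)"
  shows "h 0 = length adj"
    and "i \<le> length adj \<Longrightarrow> h (i + 1) = list_start adj i"
    and "i < length adj \<Longrightarrow> u < length (adj ! i) \<Longrightarrow> h (list_start adj i + u) = adj ! i ! u"
proof -
  have h: "h a = (if a < length (encoding adj) then encoding adj ! a else 0)" for a
    by (simp add: assms input_state_def)
  show "h 0 = length adj" by (simp add: h length_encoding) (simp add: encoding_def)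
  show "h (i + 1) = list_start adj i" if "i \<le> length adj"
    using that by (simp add: h length_encoding)
      (simp add: encoding_def nth_append nth_map list_start_def del: upt_Suc)
  show "h (list_start adj i + u) = adj ! i ! u" if "i < length adj" "u < length (adj ! i)"
    using concat_nth[OF that]
    by (simp add: h length_encoding list_start_def) (simp add: encoding_def nth_append del: upt_Suc)
qed

lemma input_memory_le:
  assumes "\<And>ys j. ys \<in> set adj \<Longrightarrow> j \<in> set ys \<Longrightarrow> j < length adj"
  shows "snd (input_state adj) a \<le> length adj + 2 + length (concat adj)"
proof (cases "a < length (encoding adj)")
  case True
  have "v \<le> length adj + 2 + length (concat adj)" if v: "v \<in> set (encoding adj)" for v
  proof -
    consider (size) "v = length adj" | (address) i where "v = list_start adj i"
      | (neighbour) "v \<in> set (concat adj)"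
      using v unfolding encoding_def list_start_def by (auto simp del: upt_Suc)
    then show ?thesis
    proof cases
      case address
      then show ?thesis using list_start_le by simp
    next
      case neighbour
      then show ?thesis using assms by fastforce
    qed simp
  qed
  then show ?thesis using True by (simp add: input_state_def)
qed (simp add: input_state_def)

locale stored_graph =
  fixes V :: "'a set" and E :: "'a set set" and vs :: "'a list" and adj :: "nat list list"
  assumes graph: "simple_graph V E" and input: "adjacency_lists V E vs adj"
begin

lemma distinct_vs: "distinct vs" and set_vs: "set vs = V"
  and length_vs: "length vs = card V" and length_adj: "length adj = card V"
  using input distinct_card[of vs] by (auto simp: adjacency_lists_def)

lemma adj_nth:
  assumes "i < card V"
  shows "distinct (adj ! i)" "set (adj ! i) = {j. j < card V \<and> {vs ! i, vs ! j} \<in> E}"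
  using input assms length_vs by (simp_all add: adjacency_lists_def)

lemma bij_betw_vs: "bij_betw ((!) vs) {..<card V} V"
  using bij_betw_nth[OF distinct_vs refl set_vs[symmetric]] length_vs by simp

definition num :: "'a \<Rightarrow> nat" where
  "num = inv_into {..<card V} ((!) vs)"

lemma bij_betw_num: "bij_betw num V {..<card V}"
  unfolding num_def by (rule bij_betw_inv_into[OF bij_betw_vs])

lemma inj_on_num: "inj_on num V"
  by (rule bij_betw_imp_inj_on[OF bij_betw_num])

lemma num_less: "v \<in> V \<Longrightarrow> num v < card V"
  using bij_betw_apply[OF bij_betw_num] by simp

lemma vs_num: "v \<in> V \<Longrightarrow> vs ! num v = v"
  unfolding num_def by (rule bij_betw_inv_into_right[OF bij_betw_vs])

lemma num_vs: "i < card V \<Longrightarrow> num (vs ! i) = i"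
  unfolding num_def by (rule bij_betw_inv_into_left[OF bij_betw_vs]) simp

lemma set_adj_num:
  assumes "v \<in> V"
  shows "set (adj ! num v) = num ` {w. {v, w} \<in> E}"
proof -
  have "set (adj ! num v) = {j. j < card V \<and> {v, vs ! j} \<in> E}"
    using adj_nth(2)[OF num_less] vs_num assms by simp
  also have "\<dots> = num ` {w. {v, w} \<in> E}"
  proof (intro equalityI subsetI)
    fix j assume "j \<in> {j. j < card V \<and> {v, vs ! j} \<in> E}"
    then show "j \<in> num ` {w. {v, w} \<in> E}" using num_vs by (intro image_eqI[of _ _ "vs ! j"]) auto
  next
    fix j assume "j \<in> num ` {w. {v, w} \<in> E}"
    then show "j \<in> {j. j < card V \<and> {v, vs ! j} \<in> E}"
      using simple_graph_edgeD(3)[OF graph] num_less vs_num by auto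
  qed
  finally show ?thesis .
qed

lemma length_adj_num:
  assumes "v \<in> V"
  shows "length (adj ! num v) = degree E v"
proof -
  have "inj_on num {w. {v, w} \<in> E}"
    by (rule inj_on_subset[OF inj_on_num]) (use simple_graph_edgeD(3)[OF graph] in blast)
  then show ?thesis
    using distinct_card[OF adj_nth(1)[OF num_less[OF assms]]] set_adj_num[OF assms]
    by (simp add: degree_def card_image)
qed

lemma length_concat_adj: "length (concat adj) = (\<Sum>v\<in>V. degree E v)"
proof -
  have "length (concat adj) = (\<Sum>i<card V. length (adj ! i))"
    by (simp add: length_concat sum_list_sum_nth length_adj atLeast0LessThan)
  also have "\<dots> = (\<Sum>v\<in>V. length (adj ! num v))"
    by (rule sum.reindex_bij_betw[OF bij_betw_num, symmetric])
  finally show ?thesis by (simp add: length_adj_num)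
qed

abbreviation mem :: "nat \<Rightarrow> nat" where
  "mem \<equiv> snd (input_state adj)"

lemma input_state_eq: "input_state adj = (\<lambda>_. 0, mem)"
  by (simp add: input_state_def)

lemma mem_0: "mem 0 = card V"
  using input_memory(1)[OF refl, of adj] length_adj by simp

lemma mem_Suc: "i \<le> card V \<Longrightarrow> mem (i + 1) = list_start adj i"
  using input_memory(2)[OF refl, of i adj] length_adj by simp

lemma mem_last: "mem (card V + 1) = card V + 2 + (\<Sum>v\<in>V. degree E v)"
  using mem_Suc[of "card V"] list_start_length[of adj] length_adj length_concat_adj by simp

lemma mem_le: "mem a \<le> card V + 2 + (\<Sum>v\<in>V. degree E v)"
proof -
  have "j < length adj" if "ys \<in> set adj" "j \<in> set ys" for ys j
    using that adj_nth(2) length_adj by (force simp: in_set_conv_nth)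
  then show ?thesis using input_memory_le[of adj a] length_adj length_concat_adj by simp
qed

lemma mem_end_num:
  assumes "v \<in> V"
  shows "mem (num v + 2) = mem (num v + 1) + degree E v"
  using mem_Suc[of "num v"] mem_Suc[of "Suc (num v)"] num_less[OF assms]
    list_start_Suc[of "num v" adj] length_adj length_adj_num[OF assms] by simp

lemma mem_degree_num: "v \<in> V \<Longrightarrow> mem_degree mem (num v) = degree E v"
  using mem_end_num by (simp add: mem_degree_def)

lemma mem_nbr_num:
  assumes "v \<in> V" "i < degree E v"
  shows "mem_nbr mem (num v) i = adj ! num v ! i"
  using input_memory(3)[OF refl, of "num v" adj i] mem_Suc[of "num v"] num_less[OF assms(1)]
    assms(2) length_adj length_adj_num[OF assms(1)] by (simp add: mem_nbr_def)

lemma mem_nbr_degree_two: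
  assumes "v \<in> V" "{w. {v, w} \<in> E} = {a, b}" "a \<noteq> b"
  shows "mem_nbr mem (num v) 0 + mem_nbr mem (num v) 1 = num a + num b"
proof -
  have deg: "degree E v = 2" using assms(2,3) by (simp add: degree_def)
  then obtain c d where cd: "adj ! num v = [c, d]"
    using length_adj_num[OF assms(1)] by (metis length_0_conv length_Suc_conv numeral_2_eq_2)
  then have "{c, d} = {num a, num b}" using set_adj_num[OF assms(1)] assms(2) by simp
  moreover have "c \<noteq> d" using adj_nth(1)[OF num_less[OF assms(1)]] cd by simp
  ultimately have "c + d = num a + num b" by (auto simp: doubleton_eq_iff)
  then show ?thesis using mem_nbr_num[OF assms(1)] deg cd by simp
qed

end

locale melon_input = simple_melon I len x s t +
    stored_graph "melon.verts I len x s t" "melon.edges I len x" vs adj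
  for I :: "'i set" and len :: "'i \<Rightarrow> nat" and x :: "'i \<Rightarrow> nat \<Rightarrow> 'v" and s t :: 'v
    and vs :: "'v list" and adj :: "nat list list"
begin

lemma melon_input_mirror: "melon_input I len (\<lambda>i j. x i (len i - j)) t s vs adj"
  by (intro melon_input.intro simple_melon_mirror stored_graph.intro)
    (use graph input in \<open>simp_all add: verts_mirror edges_mirror\<close>)

lemma mem_number_of_paths: "mem (card verts + 1) + 2 = 3 * card verts + 2 * card I"
  using mem_last sum_degrees by simp

lemma mem_less: "mem a < 5 * card verts"
  using mem_le[of a] sum_degrees card_I_less by linarith

lemma obtain_paths_in_order:
  obtains ps where "distinct ps" "set ps = I"
    "\<And>u. u < card I \<Longrightarrow> mem_nbr mem (num s) u = num (x (ps ! u) 1)"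
proof -
  define first where "first i = num (x i 1)" for i
  define ps where "ps = map (inv_into I first) (adj ! num s)"
  have "x i 1 \<in> verts" if "i \<in> I" for i using x_in_verts[OF that] len_pos[OF that] by simp
  then have "inj_on num ((\<lambda>i. x i 1) ` I)" by (intro inj_on_subset[OF inj_on_num]) blast
  then have inj: "inj_on first I"
    using comp_inj_on[OF inj_on_first] by (simp add: first_def[abs_def] comp_def)
  have set_adj: "set (adj ! num s) = first ` I"
    using set_adj_num[OF s_in_verts] neighbours_s by (simp add: first_def[abs_def] image_image)
  have "distinct ps"
    unfolding ps_def
    using adj_nth(1)[OF num_less[OF s_in_verts]] inj_on_inv_into[of _ first I] set_adj
    by (simp add: distinct_map)
  moreover have "set ps = I" using inj by (simp add: ps_def set_adj)
  moreover have "mem_nbr mem (num s) u = num (x (ps ! u) 1)" if "u < card I" for u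
  proof -
    have u: "u < length (adj ! num s)" using that length_adj_num[OF s_in_verts] degree_s by simp
    then have "first (ps ! u) = adj ! num s ! u"
      using f_inv_into_f[of "adj ! num s ! u" first I] set_adj nth_mem[OF u] by (simp add: ps_def)
    then show ?thesis using mem_nbr_num[OF s_in_verts] that degree_s by (simp add: first_def)
  qed
  ultimately show ?thesis using that by blast
qed

end

subsection \<open>Running programs\<close>

text \<open>
  The argument \<open>t\<close> is the time at which \<open>p\<close> starts; handing the time on keeps the rule for
  sequential composition free of arithmetic.
\<close>

definition runs :: "nat \<Rightarrow> com \<Rightarrow> nat \<Rightarrow> state \<Rightarrow> (nat \<Rightarrow> state \<Rightarrow> bool) \<Rightarrow> bool" where
  "runs W p t \<sigma> Q \<longleftrightarrow> (\<exists>n \<sigma>'. exec W p \<sigma> n \<sigma>' \<and> Q (t + n) \<sigma>')"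

lemma runs_exec_iff: "exec W p \<sigma> n \<sigma>' \<Longrightarrow> runs W p t \<sigma> Q \<longleftrightarrow> Q (t + n) \<sigma>'"
  unfolding runs_def using exec_deterministic by blast

lemma runs_mono:
  "runs W p t \<sigma> Q \<Longrightarrow> (\<And>t' \<sigma>'. Q t' \<sigma>' \<Longrightarrow> Q' t' \<sigma>') \<Longrightarrow> runs W p t \<sigma> Q'"
  unfolding runs_def by blast

lemma runs_Const [simp]: "c < W \<Longrightarrow> runs W (Const a c) t (r, h) Q \<longleftrightarrow> Q (t + 1) (r(a := c), h)"
  by (rule runs_exec_iff) (rule exec.Const)

lemma runs_Move [simp]: "r b < W \<Longrightarrow> runs W (Move a b) t (r, h) Q \<longleftrightarrow> Q (t + 1) (r(a := r b), h)"
  by (rule runs_exec_iff) (rule exec.Move)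

lemma runs_Add [simp]:
  "r b + r c < W \<Longrightarrow> runs W (Add a b c) t (r, h) Q \<longleftrightarrow> Q (t + 1) (r(a := r b + r c), h)"
  by (rule runs_exec_iff) (rule exec.Add)

lemma runs_Sub [simp]:
  "r b - r c < W \<Longrightarrow> runs W (Sub a b c) t (r, h) Q \<longleftrightarrow> Q (t + 1) (r(a := r b - r c), h)"
  by (rule runs_exec_iff) (rule exec.Sub)

lemma runs_Load [simp]:
  "h (r b) < W \<Longrightarrow> runs W (Load a b) t (r, h) Q \<longleftrightarrow> Q (t + 1) (r(a := h (r b)), h)"
  by (rule runs_exec_iff) (rule exec.Load)

lemma runs_Seq [simp]: "runs W (Seq p q) t \<sigma> Q \<longleftrightarrow> runs W p t \<sigma> (\<lambda>t' \<sigma>'. runs W q t' \<sigma>' Q)"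
proof -
  have "exec W (Seq p q) \<sigma> n \<sigma>' \<longleftrightarrow> (\<exists>m \<tau> k. n = m + k \<and> exec W p \<sigma> m \<tau> \<and> exec W q \<tau> k \<sigma>')" for n \<sigma>'
    by (blast elim: exec_SeqE intro: exec.Seq)
  then show ?thesis unfolding runs_def by (metis add.assoc)
qed

lemma runs_IfNZ [simp]:
  "runs W (IfNZ a p q) t \<sigma> Q \<longleftrightarrow> runs W (if fst \<sigma> a \<noteq> 0 then p else q) (t + 1) \<sigma> Q"
proof -
  have "exec W (IfNZ a p q) \<sigma> n \<sigma>' \<longleftrightarrow>
      (\<exists>m. n = 1 + m \<and> exec W (if fst \<sigma> a \<noteq> 0 then p else q) \<sigma> m \<sigma>')" for n \<sigma>'
    using exec.IfTrue[of \<sigma> a W p _ \<sigma>' q] exec.IfFalse[of \<sigma> a W q _ \<sigma>' p]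
    by (auto elim: exec_IfNZE)
  then show ?thesis unfolding runs_def by (metis add.assoc)
qed

lemma runs_WhileNZ_exit: "fst \<sigma> a = 0 \<Longrightarrow> runs W (WhileNZ a p) t \<sigma> Q \<longleftrightarrow> Q (t + 1) \<sigma>"
  by (rule runs_exec_iff) (rule exec.WhileFalse)

lemma runs_WhileNZ_step:
  assumes "fst \<sigma> a \<noteq> 0"
  shows "runs W (WhileNZ a p) t \<sigma> Q \<longleftrightarrow>
    runs W p (t + 1) \<sigma> (\<lambda>t' \<sigma>'. runs W (WhileNZ a p) t' \<sigma>' Q)"
proof -
  have "exec W (WhileNZ a p) \<sigma> n \<sigma>' \<longleftrightarrow>
      (\<exists>m \<tau> k. n = 1 + m + k \<and> exec W p \<sigma> m \<tau> \<and> exec W (WhileNZ a p) \<tau> k \<sigma>')" for n \<sigma>'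
  proof
    assume "exec W (WhileNZ a p) \<sigma> n \<sigma>'"
    then show "\<exists>m \<tau> k. n = 1 + m + k \<and> exec W p \<sigma> m \<tau> \<and> exec W (WhileNZ a p) \<tau> k \<sigma>'"
      by (cases rule: exec_WhileNZE) (use assms in auto)
  qed (use exec.WhileTrue[OF assms] in blast)
  then show ?thesis by (subst runs_def, simp only:) (fastforce simp: runs_def add.assoc)
qed

fun seq :: "com list \<Rightarrow> com" where
  "seq [] = Skip" |
  "seq [p] = p" |
  "seq (p # q # ps) = Seq p (seq (q # ps))"

definition unchanged_off :: "nat set \<Rightarrow> (nat \<Rightarrow> nat) \<Rightarrow> (nat \<Rightarrow> nat) \<Rightarrow> bool" where
  "unchanged_off A r r' \<longleftrightarrow> (\<forall>a. a \<notin> A \<longrightarrow> r' a = r a)"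

subsection \<open>The program\<close>

abbreviation (input) result_reg :: nat where "result_reg \<equiv> 0"
abbreviation (input) size_reg :: nat where "size_reg \<equiv> 1"
abbreviation (input) paths_reg :: nat where "paths_reg \<equiv> 2"
abbreviation (input) one_reg :: nat where "one_reg \<equiv> 3"
abbreviation (input) two_reg :: nat where "two_reg \<equiv> 4"
abbreviation (input) source_reg :: nat where "source_reg \<equiv> 5"
abbreviation (input) list_reg :: nat where "list_reg \<equiv> 6"
abbreviation (input) list_end_reg :: nat where "list_end_reg \<equiv> 7"
abbreviation (input) walking_reg :: nat where "walking_reg \<equiv> 8"
abbreviation (input) todo_reg :: nat where "todo_reg \<equiv> 9"
abbreviation (input) evens_reg :: nat where "evens_reg \<equiv> 10"
abbreviation (input) prev_reg :: nat where "prev_reg \<equiv> 11"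
abbreviation (input) cur_reg :: nat where "cur_reg \<equiv> 12"
abbreviation (input) parity_reg :: nat where "parity_reg \<equiv> 13"
abbreviation (input) double_reg :: nat where "double_reg \<equiv> 14"
abbreviation (input) tmp_reg :: nat where "tmp_reg \<equiv> 15"
abbreviation (input) addr_reg :: nat where "addr_reg \<equiv> 16"
abbreviation (input) deg_reg :: nat where "deg_reg \<equiv> 17"

abbreviation (input) find_regs :: "nat set" where
  "find_regs \<equiv> {source_reg, list_reg, list_end_reg, todo_reg, tmp_reg, deg_reg}"

abbreviation (input) walk_regs :: "nat set" where
  "walk_regs \<equiv> {walking_reg, prev_reg, cur_reg, parity_reg, tmp_reg, addr_reg, deg_reg}"

abbreviation (input) scan_regs :: "nat set" where
  "scan_regs \<equiv> {list_reg, todo_reg, evens_reg} \<union> walk_regs"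

definition halve_body :: com where
  "halve_body = seq [Add result_reg result_reg one_reg, Sub double_reg double_reg two_reg]"

definition halve_loop :: com where
  "halve_loop = WhileNZ double_reg halve_body"

text \<open>
  Subtraction is truncated, so \<open>deg_reg\<close> ends up zero iff the degree is at most two. The loop leaves
  the number of the vertex found, plus one, in \<open>source_reg\<close>.
\<close>

definition find_body :: com where
  "find_body = seq [Add source_reg source_reg one_reg, Load list_reg source_reg,
     Add tmp_reg source_reg one_reg, Load list_end_reg tmp_reg,
     Sub deg_reg list_end_reg list_reg, Sub deg_reg deg_reg two_reg, Sub todo_reg one_reg deg_reg]"

definition find_loop :: com where
  "find_loop = WhileNZ todo_reg find_body"

text \<open>
  A vertex of degree two is left through the sum of its two neighbours minus the previous vertex.
\<close>

definition walk_step :: com where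
  "walk_step = seq [Load tmp_reg addr_reg, Add addr_reg addr_reg one_reg, Load addr_reg addr_reg,
     Add tmp_reg tmp_reg addr_reg, Sub tmp_reg tmp_reg prev_reg, Move prev_reg cur_reg,
     Move cur_reg tmp_reg, Sub parity_reg one_reg parity_reg]"

definition walk_body :: com where
  "walk_body = seq [Add tmp_reg cur_reg one_reg, Load addr_reg tmp_reg, Add tmp_reg tmp_reg one_reg,
     Load deg_reg tmp_reg, Sub deg_reg deg_reg addr_reg, Sub deg_reg deg_reg two_reg,
     IfNZ deg_reg (Const walking_reg 0) walk_step]"

definition walk_loop :: com where
  "walk_loop = WhileNZ walking_reg walk_body"

definition scan_advance :: com where
  "scan_advance = seq [Sub parity_reg one_reg parity_reg, Add evens_reg evens_reg parity_reg,
     Add list_reg list_reg one_reg, Sub todo_reg list_end_reg list_reg]"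

definition scan_body :: com where
  "scan_body = seq [Move prev_reg source_reg, Load cur_reg list_reg, Const parity_reg 1,
     Const walking_reg 1, walk_loop, scan_advance]"

definition scan_loop :: com where
  "scan_loop = WhileNZ todo_reg scan_body"

definition double_evc :: com where
  "double_evc = seq [Sub tmp_reg evens_reg one_reg,
     IfNZ tmp_reg
       (seq [Add double_reg size_reg two_reg, Add double_reg double_reg two_reg,
         Sub double_reg double_reg evens_reg])
       (Add double_reg size_reg evens_reg)]"

definition scan_paths :: com where
  "scan_paths = seq [Sub source_reg source_reg one_reg, Const evens_reg 0,
     Sub todo_reg list_end_reg list_reg, scan_loop]"

definition count_even_paths :: com where
  "count_even_paths = seq [Const source_reg 0, Const todo_reg 1, find_loop, scan_paths, double_evc]"

text \<open>
  The total length of the adjacency lists of a melon with \<open>n\<close> vertices and \<open>k\<close> paths is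
  \<open>2 * n + 2 * k - 4\<close>; \<open>paths_reg\<close> receives \<open>2 * k - 2\<close>.
\<close>

definition read_parameters :: com where
  "read_parameters = seq [Load size_reg 0, Const one_reg 1, Const two_reg 2,
     Add tmp_reg size_reg one_reg, Load paths_reg tmp_reg, Sub paths_reg paths_reg size_reg,
     Sub paths_reg paths_reg size_reg, Sub paths_reg paths_reg size_reg]"

definition compute_evc :: com where
  "compute_evc = IfNZ paths_reg
     (seq [Sub paths_reg paths_reg two_reg,
       IfNZ paths_reg count_even_paths (Move double_reg size_reg), halve_loop])
     (Sub result_reg size_reg one_reg)"

definition melon_program :: com where
  "melon_program = Seq read_parameters compute_evc"

subsection \<open>Correctness and running time\<close>

lemmas halve_loop_step = runs_WhileNZ_step[of _ double_reg _ halve_body, folded halve_loop_def]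
lemmas find_loop_step = runs_WhileNZ_step[of _ todo_reg _ find_body, folded find_loop_def]
lemmas walk_loop_step = runs_WhileNZ_step[of _ walking_reg _ walk_body, folded walk_loop_def]
lemmas scan_loop_step = runs_WhileNZ_step[of _ todo_reg _ scan_body, folded scan_loop_def]

lemmas halve_loop_exit = runs_WhileNZ_exit[of _ double_reg _ halve_body, folded halve_loop_def]
lemmas find_loop_exit = runs_WhileNZ_exit[of _ todo_reg _ find_body, folded find_loop_def]
lemmas walk_loop_exit = runs_WhileNZ_exit[of _ walking_reg _ walk_body, folded walk_loop_def]
lemmas scan_loop_exit = runs_WhileNZ_exit[of _ todo_reg _ scan_body, folded scan_loop_def]

lemma runs_halve_loop:
  assumes "r one_reg = 1" "r two_reg = 2" "r result_reg + r double_reg < W"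
    and "\<And>t' r'. t' \<le> t + 3 * r double_reg + 1 \<Longrightarrow>
      r' result_reg = r result_reg + (r double_reg + 1) div 2 \<Longrightarrow> Q t' (r', h)"
  shows "runs W halve_loop t (r, h) Q"
  using assms
proof (induction "r double_reg" arbitrary: r t rule: less_induct)
  case less
  show ?case
  proof (cases "r double_reg = 0")
    case True
    then show ?thesis using less.prems(4)[of "t + 1" r] by (simp add: halve_loop_exit)
  next
    case False
    let ?r = "r(result_reg := r result_reg + 1, double_reg := r double_reg - 2)"
    have "?r result_reg + (?r double_reg + 1) div 2 = r result_reg + (r double_reg + 1) div 2"
      using False by (simp, presburger)
    then have "runs W halve_loop (t + 3) (?r, h) Q"
      by (intro less.hyps) (use less.prems False in auto)
    then show ?thesis
      using less.prems(1-3) False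
      by (simp add: halve_loop_step halve_body_def less_imp_diff_less eval_nat_numeral)
  qed
qed

lemma runs_find_loop:
  assumes h: "\<And>a. h a < W" and v: "v + 2 < W" "3 \<le> mem_degree h v"
    and "r one_reg = 1" "r two_reg = 2" "r todo_reg \<noteq> 0" "r source_reg \<le> v"
    and "\<And>u. r source_reg \<le> u \<Longrightarrow> u < v \<Longrightarrow> mem_degree h u \<le> 2"
    and "\<And>t' r'. t' \<le> t + 8 * (v - r source_reg) + 9 \<Longrightarrow>
      unchanged_off find_regs r r' \<Longrightarrow> r' source_reg = v + 1 \<Longrightarrow> r' list_reg = h (v + 1) \<Longrightarrow>
      r' list_end_reg = h (v + 2) \<Longrightarrow> Q t' (r', h)"
  shows "runs W find_loop t (r, h) Q"
  using assms(4-)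
proof (induction "v - r source_reg" arbitrary: r t)
  case 0
  then have source: "r source_reg = v" by simp
  have "runs W find_body (t + 1) (r, h) (\<lambda>t' \<sigma>. runs W find_loop t' \<sigma> Q)"
    using "0.prems"(1,2) source h v
    by (simp add: find_body_def less_imp_diff_less mem_degree_def find_loop_exit)
      (rule "0.prems"(6); simp add: source unchanged_off_def)
  then show ?case using "0.prems"(3) by (simp add: find_loop_step)
next
  case (Suc d)
  have source: "r source_reg < v" using Suc.hyps(2) by linarith
  moreover from this have "h (Suc (Suc (r source_reg))) - Suc (Suc (h (Suc (r source_reg)))) = 0"
    using Suc.prems(5)[of "r source_reg"] by (simp add: mem_degree_def)
  ultimately have "runs W find_body (t + 1) (r, h) (\<lambda>t' \<sigma>. runs W find_loop t' \<sigma> Q)"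
    using Suc.prems(1,2) h v
    by (simp add: find_body_def less_imp_diff_less)
      (rule Suc.hyps(1);
        use Suc.prems(1,2,5) Suc.hyps(2) source in
          \<open>auto simp: unchanged_off_def intro!: Suc.prems(6)\<close>)
  then show ?case using Suc.prems(3) by (simp add: find_loop_step)
qed

definition stored_path :: "nat \<Rightarrow> (nat \<Rightarrow> nat) \<Rightarrow> nat \<Rightarrow> (nat \<Rightarrow> nat) \<Rightarrow> bool" where
  "stored_path B h l y \<longleftrightarrow> 0 < l \<and> (\<forall>j\<le>l. y j < B) \<and> 3 \<le> mem_degree h (y l) \<and>
     (\<forall>j. 0 < j \<and> j < l \<longrightarrow> mem_degree h (y j) = 2 \<and>
        mem_nbr h (y j) 0 + mem_nbr h (y j) 1 = y (j - 1) + y (j + 1))"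

lemma runs_walk_loop:
  assumes h: "\<And>a. h a < B" and W: "2 * B + 2 < W" and path: "stored_path B h l y"
    and "0 < j" "j \<le> l" "r one_reg = 1" "r two_reg = 2" "r walking_reg \<noteq> 0"
    and "r prev_reg = y (j - 1)" "r cur_reg = y j" "r parity_reg = of_bool (odd j)"
    and "\<And>t' r'. t' \<le> t + 16 * (l - j) + 10 \<Longrightarrow>
      unchanged_off walk_regs r r' \<Longrightarrow>
      r' parity_reg = of_bool (odd l) \<Longrightarrow> Q t' (r', h)"
  shows "runs W walk_loop t (r, h) Q"
  using assms(4-)
proof (induction "l - j" arbitrary: r t j)
  case 0
  then have j: "j = l" by simp
  have W': "h a < W" "y l + 2 < W" for a
    using h[of a] W path by (auto simp: stored_path_def dest!: spec[of _ l])
  have deg: "Suc (Suc (h (Suc (y l)))) < h (Suc (Suc (y l)))"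
    using path by (auto simp: stored_path_def mem_degree_def)
  have "runs W walk_body (t + 1) (r, h) (\<lambda>t' \<sigma>. runs W walk_loop t' \<sigma> Q)"
    using "0.prems"(3,4,7) W' deg
    by (simp add: walk_body_def less_imp_diff_less walk_loop_exit j)
      (rule "0.prems"(9); use "0.prems"(8) in \<open>simp add: j unchanged_off_def\<close>)
  then show ?case using "0.prems"(5) by (simp add: walk_loop_step)
next
  case (Suc d)
  have j: "j < l" using Suc.hyps(2) by simp
  have "y (j - 1) < B" "y j < B" "y (j + 1) < B" using path j by (simp_all add: stored_path_def)
  then have W': "y j + 2 < W" "y (j - 1) < W" "y (j + 1) < W" "y (j - 1) + y (j + 1) < W"
    and hW: "h a + 1 < W" for a
    using W h[of a] by simp_all
  have deg: "h (Suc (Suc (y j))) - h (Suc (y j)) = 2"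
    and nbr: "h (h (Suc (y j))) + h (Suc (h (Suc (y j)))) = y (j - 1) + y (j + 1)"
    using path j Suc.prems(1) by (simp_all add: stored_path_def mem_degree_def mem_nbr_def)
  have "runs W walk_body (t + 1) (r, h) (\<lambda>t' \<sigma>. runs W walk_loop t' \<sigma> Q)"
    using Suc.prems(3,4,6-8) deg nbr W' hW
    by (simp add: walk_body_def walk_step_def Suc_lessD)
      (intro conjI impI Suc.hyps(1)[of "Suc j"];
        use Suc.prems(3-5) Suc.hyps(2) j in \<open>auto simp: unchanged_off_def intro!: Suc.prems(9)\<close>)
  then show ?case using Suc.prems(5) by (simp add: walk_loop_step)
qed

lemma runs_scan_advance:
  assumes "r one_reg = 1" "r parity_reg = of_bool (odd l)"
    and "r evens_reg + 1 < W" "r list_reg + 1 < W" "r list_end_reg < W"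
  shows "runs W scan_advance t (r, h) Q \<longleftrightarrow>
    Q (t + 4) (r(parity_reg := of_bool (even l), evens_reg := r evens_reg + of_bool (even l),
      list_reg := r list_reg + 1, todo_reg := r list_end_reg - (r list_reg + 1)), h)"
  using assms
  by (cases "even l") (simp_all add: scan_advance_def less_imp_diff_less eval_nat_numeral)

lemma runs_scan_body:
  assumes h: "\<And>a. h a < B" and W: "2 * B + 2 < W"
    and path: "stored_path B h l y" "y 0 = r source_reg" "y 1 = h (r list_reg)"
    and r: "r one_reg = 1" "r two_reg = 2" "r source_reg < B" "r list_reg < B" "r list_end_reg < B"
      "r evens_reg < B"
    and Q: "\<And>t' r'. t' \<le> t + 16 * l + 2 \<Longrightarrow> unchanged_off scan_regs r r' \<Longrightarrow>
      r' list_reg = r list_reg + 1 \<Longrightarrow> r' todo_reg = r list_end_reg - (r list_reg + 1) \<Longrightarrow>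
      r' evens_reg = r evens_reg + of_bool (even l) \<Longrightarrow> Q t' (r', h)"
  shows "runs W scan_body t (r, h) Q"
proof -
  let ?r = "r(prev_reg := r source_reg, cur_reg := h (r list_reg), parity_reg := 1,
    walking_reg := 1)"
  have l: "0 < l" using path(1) by (simp add: stored_path_def)
  have "runs W walk_loop (t + 4) (?r, h) (\<lambda>t' \<sigma>. runs W scan_advance t' \<sigma> Q)"
  proof (rule runs_walk_loop[OF h W path(1), where j = 1])
    fix t' r'
    assume t': "t' \<le> t + 4 + 16 * (l - 1) + 10" and off: "unchanged_off walk_regs ?r r'"
      and parity: "r' parity_reg = of_bool (odd l)"
    have "r' one_reg = 1" "r' list_reg = r list_reg" "r' list_end_reg = r list_end_reg"
      "r' evens_reg = r evens_reg"
      using off r(1) by (simp_all add: unchanged_off_def)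
    then show "runs W scan_advance t' (r', h) Q"
      using parity W r(4-6) t' l off
      by (subst runs_scan_advance) (auto simp: unchanged_off_def intro!: Q)
  qed (use path r l in auto)
  then show ?thesis using W r(3) h[of "r list_reg"] by (simp add: scan_body_def eval_nat_numeral)
qed

lemma runs_scan_loop:
  assumes h: "\<And>a. h a < B" and W: "2 * B + 2 < W"
    and "\<And>i. i \<in> set ps \<Longrightarrow> stored_path B h (len i) (y i)" "\<And>i. i \<in> set ps \<Longrightarrow> y i 0 = r source_reg"
    and "\<And>u. u < length ps \<Longrightarrow> h (r list_reg + u) = y (ps ! u) 1"
    and "r one_reg = 1" "r two_reg = 2"
    and "r list_end_reg = r list_reg + length ps" "r todo_reg = length ps"
    and "r evens_reg + length ps < B" "r list_end_reg < B" "r source_reg < B"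
    and "\<And>t' r'. t' \<le> t + (\<Sum>i\<leftarrow>ps. 16 * len i + 3) + 1 \<Longrightarrow> unchanged_off scan_regs r r' \<Longrightarrow>
      r' evens_reg = r evens_reg + length (filter (\<lambda>i. even (len i)) ps) \<Longrightarrow> Q t' (r', h)"
  shows "runs W scan_loop t (r, h) Q"
  using assms(3-)
proof (induction ps arbitrary: r t)
  case Nil
  then show ?case by (simp add: scan_loop_exit unchanged_off_def)
next
  case (Cons i ps)
  have "runs W scan_body (t + 1) (r, h) (\<lambda>t' \<sigma>. runs W scan_loop t' \<sigma> Q)"
  proof (rule runs_scan_body[OF h W, where l = "len i" and y = "y i"])
    fix t' r'
    assume t': "t' \<le> t + 1 + 16 * len i + 2" and off: "unchanged_off scan_regs r r'"
      and r': "r' list_reg = r list_reg + 1" "r' todo_reg = r list_end_reg - (r list_reg + 1)"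
        "r' evens_reg = r evens_reg + of_bool (even (len i))"
    show "runs W scan_loop t' (r', h) Q"
    proof (rule Cons.IH)
      show "h (r' list_reg + u) = y (ps ! u) 1" if "u < length ps" for u
        using Cons.prems(3)[of "Suc u"] that r'(1) by simp
    next
      fix t'' r''
      assume "t'' \<le> t' + (\<Sum>i\<leftarrow>ps. 16 * len i + 3) + 1" "unchanged_off scan_regs r' r''"
        and "r'' evens_reg = r' evens_reg + length (filter (\<lambda>i. even (len i)) ps)"
      then show "Q t'' (r'', h)"
        using t' off r'(3) by (intro Cons.prems(11)) (auto simp: unchanged_off_def)
    qed (use Cons.prems off r' in \<open>auto simp: unchanged_off_def\<close>)
  qed (use Cons.prems(1-10) Cons.prems(3)[of 0] in auto)
  then show ?case using Cons.prems(7) by (simp add: scan_loop_step)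
qed

lemma runs_double_evc:
  assumes "r one_reg = 1" "r two_reg = 2" "r size_reg = n" "r evens_reg = e" "n + 4 < W" "e < W"
    and "\<And>t' r'. t' \<le> t + 5 \<Longrightarrow> unchanged_off {double_reg, tmp_reg} r r' \<Longrightarrow>
      r' double_reg = (if e \<le> 1 then n + e else n + 4 - e) \<Longrightarrow> Q t' (r', h)"
  shows "runs W double_evc t (r, h) Q"
proof (cases "e \<le> 1")
  case True
  then show ?thesis using assms(1-6)
    by (simp add: double_evc_def) (rule assms(7); simp add: unchanged_off_def)
next
  case False
  then show ?thesis using assms(1-6)
    by (simp add: double_evc_def less_imp_diff_less) (rule assms(7); simp add: unchanged_off_def)
qed

definition stored_melon ::
    "nat \<Rightarrow> (nat \<Rightarrow> nat) \<Rightarrow> nat \<Rightarrow> 'p list \<Rightarrow> ('p \<Rightarrow> nat) \<Rightarrow> ('p \<Rightarrow> nat \<Rightarrow> nat) \<Rightarrow> bool" where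
  "stored_melon B h v ps len y \<longleftrightarrow> v < B \<and> length ps < B \<and> 3 \<le> length ps \<and>
     mem_degree h v = length ps \<and> (\<forall>u<v. mem_degree h u \<le> 2) \<and>
     (\<forall>u<length ps. mem_nbr h v u = y (ps ! u) 1) \<and>
     (\<forall>i\<in>set ps. stored_path B h (len i) (y i) \<and> y i 0 = v)"

lemma runs_scan_paths:
  assumes h: "\<And>a. h a < B" and W: "2 * B + 2 < W" and stored: "stored_melon B h v ps len y"
    and r: "r one_reg = 1" "r two_reg = 2" "r source_reg = v + 1" "r list_reg = h (v + 1)"
      "r list_end_reg = h (v + 2)"
    and Q: "\<And>t' r'. t' \<le> t + (\<Sum>i\<leftarrow>ps. 16 * len i + 3) + 4 \<Longrightarrow>
      unchanged_off (insert source_reg scan_regs) r r' \<Longrightarrow>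
      r' evens_reg = length (filter (\<lambda>i. even (len i)) ps) \<Longrightarrow> Q t' (r', h)"
  shows "runs W scan_paths t (r, h) Q"
proof -
  have v: "v < B" "3 \<le> length ps" "length ps < B" "mem_degree h v = length ps"
    using stored by (simp_all add: stored_melon_def)
  then have list_end: "h (v + 2) = h (v + 1) + length ps" by (simp add: mem_degree_def)
  let ?r = "r(source_reg := v, evens_reg := 0, todo_reg := length ps)"
  have "runs W scan_loop (t + 3) (?r, h) Q"
  proof (rule runs_scan_loop[OF h W, where len = len and y = y])
    fix t' r'
    assume "t' \<le> t + 3 + (\<Sum>i\<leftarrow>ps. 16 * len i + 3) + 1" "unchanged_off scan_regs ?r r'"
      and "r' evens_reg = ?r evens_reg + length (filter (\<lambda>i. even (len i)) ps)"
    then show "Q t' (r', h)" by (intro Q) (auto simp: unchanged_off_def)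
  qed (use stored r v list_end h[of "v + 2"] in \<open>simp_all add: stored_melon_def mem_nbr_def\<close>)
  then show ?thesis
    using r v list_end W by (simp add: scan_paths_def eval_nat_numeral)
qed

lemma runs_count_even_paths:
  assumes h: "\<And>a. h a < B" and W: "2 * B + 2 < W" and stored: "stored_melon B h v ps len y"
    and n: "n + 4 \<le> B" and e: "e = length (filter (\<lambda>i. even (len i)) ps)"
    and r: "r one_reg = 1" "r two_reg = 2" "r size_reg = n"
    and Q: "\<And>t' r'. t' \<le> t + 8 * v + (\<Sum>i\<leftarrow>ps. 16 * len i + 3) + 20 \<Longrightarrow>
      unchanged_off {5..} r r' \<Longrightarrow>
      r' double_reg = (if e \<le> 1 then n + e else n + 4 - e) \<Longrightarrow> Q t' (r', h)"
  shows "runs W count_even_paths t (r, h) Q"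
proof -
  have hW: "h a < W" for a using h[of a] W by simp
  have v: "v < B" "3 \<le> mem_degree h v" "\<And>u. u < v \<Longrightarrow> mem_degree h u \<le> 2" "length ps < B"
    using stored by (simp_all add: stored_melon_def)
  have "e < W" using length_filter_le[of "\<lambda>i. even (len i)" ps] e v(4) W by linarith
  let ?r = "r(source_reg := 0, todo_reg := 1)"
  have "runs W find_loop (t + 2) (?r, h)
      (\<lambda>t' \<sigma>. runs W scan_paths t' \<sigma> (\<lambda>t' \<sigma>. runs W double_evc t' \<sigma> Q))"
  proof (rule runs_find_loop[OF hW])
    fix t' r'
    assume t': "t' \<le> t + 2 + 8 * (v - ?r source_reg) + 9"
      and off': "unchanged_off find_regs ?r r'"
      and r': "r' source_reg = v + 1" "r' list_reg = h (v + 1)" "r' list_end_reg = h (v + 2)"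
    show "runs W scan_paths t' (r', h) (\<lambda>t' \<sigma>. runs W double_evc t' \<sigma> Q)"
    proof (rule runs_scan_paths[OF h W stored _ _ r'])
      fix t'' r''
      assume t'': "t'' \<le> t' + (\<Sum>i\<leftarrow>ps. 16 * len i + 3) + 4"
        and off'': "unchanged_off (insert source_reg scan_regs) r' r''"
        and evens: "r'' evens_reg = length (filter (\<lambda>i. even (len i)) ps)"
      show "runs W double_evc t'' (r'', h) Q"
        by (rule runs_double_evc[where n = n and e = e])
          (use off' off'' r e evens \<open>e < W\<close> n W t' t'' in \<open>auto simp: unchanged_off_def intro!: Q\<close>)
    qed (use off' r in \<open>simp_all add: unchanged_off_def\<close>)
  qed (use r v W in simp_all)
  then show ?thesis using W by (simp add: count_even_paths_def)
qed

lemma runs_read_parameters: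
  assumes h: "\<And>a. h a < B" and W: "2 * B + 2 < W"
    and n: "h 0 = n" "h (n + 1) + 2 = 3 * n + 2 * k"
    and Q: "\<And>t' r. t' \<le> t + 8 \<Longrightarrow> r result_reg = 0 \<Longrightarrow> r size_reg = n \<Longrightarrow> r paths_reg = 2 * k - 2 \<Longrightarrow>
      r one_reg = 1 \<Longrightarrow> r two_reg = 2 \<Longrightarrow> Q t' (r, h)"
  shows "runs W read_parameters t (\<lambda>_. 0, h) Q"
proof -
  have hW: "h a + 2 < W" for a using h[of a] W by simp
  have "h (Suc n) - n - n - n = 2 * k - 2" using n(2) by simp
  then show ?thesis
    using hW[of 0] hW[of "n + 1"] n(1)
    by (simp add: read_parameters_def less_imp_diff_less) (rule Q; simp)
qed

lemma runs_melon_program_path: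
  assumes h: "\<And>a. h a < B" and W: "2 * B + 2 < W" and n: "h 0 = n" "h (n + 1) + 2 = 3 * n + 2"
  shows "runs W melon_program 0 (\<lambda>_. 0, h) (\<lambda>t \<sigma>. t \<le> 10 \<and> result \<sigma> = n - 1)"
  unfolding melon_program_def runs_Seq
proof (rule runs_read_parameters[where h = h and k = 1, OF h W n(1)])
  fix t :: nat and r :: "nat \<Rightarrow> nat"
  assume "t \<le> 0 + 8" "r size_reg = n" "r paths_reg = 2 * 1 - 2" "r one_reg = 1"
  moreover have "n < W" using h[of 0] n(1) W by simp
  ultimately show "runs W compute_evc t (r, h) (\<lambda>t \<sigma>. t \<le> 10 \<and> result \<sigma> = n - 1)"
    by (simp add: compute_evc_def less_imp_diff_less result_def)
qed (use n(2) in simp)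

lemma runs_melon_program_cycle:
  assumes h: "\<And>a. h a < B" and W: "2 * B + 2 < W" and n: "h 0 = n" "h (n + 1) + 2 = 3 * n + 4"
  shows "runs W melon_program 0 (\<lambda>_. 0, h) (\<lambda>t \<sigma>. t \<le> 3 * n + 13 \<and> result \<sigma> = (n + 1) div 2)"
  unfolding melon_program_def runs_Seq
proof (rule runs_read_parameters[where h = h and k = 2, OF h W n(1)])
  fix t :: nat and r :: "nat \<Rightarrow> nat"
  assume r: "t \<le> 0 + 8" "r result_reg = 0" "r size_reg = n" "r paths_reg = 2 * 2 - 2"
    "r one_reg = 1" "r two_reg = 2"
  moreover have "n < W" using h[of 0] n(1) W by simp
  ultimately show "runs W compute_evc t (r, h) (\<lambda>t \<sigma>. t \<le> 3 * n + 13 \<and> result \<sigma> = (n + 1) div 2)"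
    using W by (simp add: compute_evc_def) (rule runs_halve_loop; simp add: result_def)
qed (use n(2) in simp)

lemma runs_melon_program_many_paths:
  assumes h: "\<And>a. h a < B" and W: "2 * B + 2 < W" and stored: "stored_melon B h v ps len y"
    and n: "h 0 = n" "n + 4 \<le> B" "h (n + 1) + 2 = 3 * n + 2 * length ps"
    and e: "e = length (filter (\<lambda>i. even (len i)) ps)"
  shows "runs W melon_program 0 (\<lambda>_. 0, h) (\<lambda>t \<sigma>.
    t \<le> 8 * v + (\<Sum>i\<leftarrow>ps. 16 * len i + 3) + 3 * n + 45 \<and>
    result \<sigma> = ((if e \<le> 1 then n + e else n + 4 - e) + 1) div 2)"
  unfolding melon_program_def runs_Seq
proof (rule runs_read_parameters[where h = h, OF h W n(1,3)])
  let ?Q = "\<lambda>t \<sigma>. t \<le> 8 * v + (\<Sum>i\<leftarrow>ps. 16 * len i + 3) + 3 * n + 45 \<and>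
    result \<sigma> = ((if e \<le> 1 then n + e else n + 4 - e) + 1) div 2"
  have k: "3 \<le> length ps" "length ps < B" using stored by (simp_all add: stored_melon_def)
  fix t :: nat and r :: "nat \<Rightarrow> nat"
  assume r: "t \<le> 0 + 8" "r result_reg = 0" "r size_reg = n" "r paths_reg = 2 * length ps - 2"
    "r one_reg = 1" "r two_reg = 2"
  let ?r = "r(paths_reg := 2 * length ps - 4)"
  have "runs W count_even_paths (t + 3) (?r, h) (\<lambda>t' \<sigma>. runs W halve_loop t' \<sigma> ?Q)"
  proof (rule runs_count_even_paths[OF h W stored n(2) e])
    fix t' r'
    assume "t' \<le> t + 3 + 8 * v + (\<Sum>i\<leftarrow>ps. 16 * len i + 3) + 20" "unchanged_off {5..} ?r r'"
      and "r' double_reg = (if e \<le> 1 then n + e else n + 4 - e)"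
    then show "runs W halve_loop t' (r', h) ?Q"
      using r n(2) W
      by (intro runs_halve_loop) (auto simp: unchanged_off_def result_def split: if_splits)
  qed (use r in simp_all)
  then show "runs W compute_evc t (r, h) ?Q"
    using r k W by (simp add: compute_evc_def eval_nat_numeral)
qed

context melon_input
begin

lemma stored_path_num:
  assumes "3 \<le> card I" "i \<in> I"
  shows "stored_path (5 * card verts) mem (len i) (\<lambda>j. num (x i j))"
  unfolding stored_path_def
proof (intro conjI allI impI)
  show "0 < len i" by (rule len_pos[OF assms(2)])
  show "num (x i j) < 5 * card verts" if "j \<le> len i" for j
    using num_less[OF x_in_verts[OF assms(2) that]] by simp
  show "3 \<le> mem_degree mem (num (x i (len i)))"
    using assms x_len mem_degree_num[OF t_in_verts] degree_t by simp
next
  fix j assume j: "0 < j \<and> j < len i"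
  then have v: "x i j \<in> verts" using x_in_verts[OF assms(2)] by simp
  show "mem_degree mem (num (x i j)) = 2"
    using mem_degree_num[OF v] degree_inner[OF assms(2)] j by simp
  show "mem_nbr mem (num (x i j)) 0 + mem_nbr mem (num (x i j)) 1 =
      num (x i (j - 1)) + num (x i (j + 1))"
    using mem_nbr_degree_two[OF v] neighbours_inner[OF assms(2)] path_neighbours_neq[OF assms(2)] j
    by simp
qed

lemma stored_melon_num:
  assumes k: "3 \<le> card I" and first: "num s < num t" and ps: "set ps = I" "length ps = card I"
    and order: "\<And>u. u < card I \<Longrightarrow> mem_nbr mem (num s) u = num (x (ps ! u) 1)"
  shows "stored_melon (5 * card verts) mem (num s) ps len (\<lambda>i j. num (x i j))"
  unfolding stored_melon_def
proof (intro conjI allI impI ballI)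
  show "num s < 5 * card verts" using num_less[OF s_in_verts] by simp
  show "length ps < 5 * card verts" "3 \<le> length ps" using ps k card_I_less by simp_all
  show "mem_degree mem (num s) = length ps" using mem_degree_num[OF s_in_verts] degree_s ps by simp
  show "mem_nbr mem (num s) u = num (x (ps ! u) 1)" if "u < length ps" for u
    using order that ps by simp
  show "stored_path (5 * card verts) mem (len i) (\<lambda>j. num (x i j))" "num (x i 0) = num s"
    if "i \<in> set ps" for i using that ps stored_path_num[OF k] x_0 by simp_all
next
  fix u assume u: "u < num s"
  then have "u < card verts" using num_less[OF s_in_verts] by simp
  moreover from this have "vs ! u \<in> verts" using bij_betw_apply[OF bij_betw_vs] by simp
  moreover have "vs ! u \<noteq> s" "vs ! u \<noteq> t" using num_vs[OF \<open>u < card verts\<close>] u first by auto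
  ultimately show "mem_degree mem u \<le> 2"
    using mem_degree_num[of "vs ! u"] degree_not_end[of "vs ! u"] num_vs by simp
qed

lemma runs_melon_program_source_first:
  assumes W: "10 * card verts + 2 < W" and k: "3 \<le> card I" and first: "num s < num t"
  shows "runs W melon_program 0 (input_state adj)
    (\<lambda>t \<sigma>. t \<le> 100 * card verts \<and> result \<sigma> = evc verts edges)"
proof -
  obtain ps where ps: "distinct ps" "set ps = I"
    and order: "\<And>u. u < card I \<Longrightarrow> mem_nbr mem (num s) u = num (x (ps ! u) 1)"
    using obtain_paths_in_order by blast
  have length_ps: "length ps = card I" using distinct_card[OF ps(1)] ps(2) by simp
  have evens: "card evens = length (filter (\<lambda>i. even (len i)) ps)"
    using distinct_card[of "filter (\<lambda>i. even (len i)) ps"] ps by (simp add: evens_def)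
  have n: "4 \<le> card verts" using card_I_less k by simp
  have "(\<Sum>i\<leftarrow>ps. 16 * len i + 3) = 16 * (\<Sum>i\<in>I. len i) + 3 * card I"
    using sum_list_distinct_conv_sum_set[OF ps(1), of "\<lambda>i. 16 * len i + 3"] ps(2)
    by (simp add: sum.distrib sum_distrib_left)
  then have time: "8 * num s + (\<Sum>i\<leftarrow>ps. 16 * len i + 3) + 3 * card verts + 45 \<le> 100 * card verts"
    using sum_len card_I_less num_less[OF s_in_verts] n by linarith
  have evc: "evc verts edges =
      ((if card evens \<le> 1 then card verts + card evens else card verts + 4 - card evens) + 1) div 2"
    unfolding evc_eq_melon_evc melon_evc_def using k by simp
  have "runs W melon_program 0 (\<lambda>_. 0, mem) (\<lambda>t \<sigma>.
      t \<le> 8 * num s + (\<Sum>i\<leftarrow>ps. 16 * len i + 3) + 3 * card verts + 45 \<and>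
      result \<sigma> = ((if card evens \<le> 1 then card verts + card evens
        else card verts + 4 - card evens) + 1) div 2)"
    by (rule runs_melon_program_many_paths[where h = mem, OF mem_less _
          stored_melon_num[OF k first ps(2) length_ps order] mem_0 _ _ evens])
      (use W n mem_number_of_paths length_ps in simp_all)
  then show ?thesis unfolding evc by (subst input_state_eq, rule runs_mono) (use time in auto)
qed

theorem melon_program_correct:
  assumes W: "10 * card verts + 2 < W"
  shows "runs W melon_program 0 (input_state adj)
    (\<lambda>t \<sigma>. t \<le> 100 * card verts \<and> result \<sigma> = evc verts edges)"
proof -
  have n: "2 \<le> card verts" by (simp add: card_verts)
  have W': "2 * (5 * card verts) + 2 < W" using W by simp
  have "0 < card I" using finite_I I_nonempty by (simp add: card_gt_0_iff)
  moreover have "num s \<noteq> num t"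
    using inj_onD[OF inj_on_num _ s_in_verts t_in_verts] s_neq_t by blast
  ultimately consider (path) "card I = 1" | (cycle) "card I = 2"
    | (source_first) "3 \<le> card I" "num s < num t" | (sink_first) "3 \<le> card I" "num t < num s"
    by linarith
  then show ?thesis
  proof cases
    case path
    then have "runs W melon_program 0 (\<lambda>_. 0, mem) (\<lambda>t \<sigma>. t \<le> 10 \<and> result \<sigma> = card verts - 1)"
      using mem_number_of_paths
      by (intro runs_melon_program_path[where h = mem, OF mem_less W' mem_0]) simp
    then show ?thesis
      by (subst input_state_eq, elim runs_mono)
        (use n path evc_eq_melon_evc in \<open>auto simp: melon_evc_def\<close>)
  next
    case cycle
    then have "runs W melon_program 0 (\<lambda>_. 0, mem)
        (\<lambda>t \<sigma>. t \<le> 3 * card verts + 13 \<and> result \<sigma> = (card verts + 1) div 2)"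
      using mem_number_of_paths
      by (intro runs_melon_program_cycle[where h = mem, OF mem_less W' mem_0]) simp
    then show ?thesis
      by (subst input_state_eq, elim runs_mono)
        (use n cycle evc_eq_melon_evc in \<open>auto simp: melon_evc_def\<close>)
  next
    case source_first
    then show ?thesis by (rule runs_melon_program_source_first[OF W])
  next
    case sink_first
    interpret mirror: melon_input I len "\<lambda>i j. x i (len i - j)" t s vs adj
      by (rule melon_input_mirror)
    show ?thesis
      using mirror.runs_melon_program_source_first W sink_first
      by (simp add: verts_mirror edges_mirror)
  qed
qed

end

lemma word_size_bound: "2 \<le> n \<Longrightarrow> 10 * n + 2 < (n + m + 2) ^ 4" for n m :: nat
proof -
  assume "2 \<le> n"
  then have "4 ^ 3 \<le> (n + m + 2) ^ 3" by (intro power_mono) auto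
  then have "(n + m + 2) * 4 ^ 3 \<le> (n + m + 2) * (n + m + 2) ^ 3" by (rule mult_le_mono2)
  then show ?thesis by (simp add: power_Suc[symmetric])
qed

theorem theorem1:
  "\<exists>(p :: com) (c :: nat) (d :: nat).
     \<forall>(V :: nat set) (E :: nat set set) (vs :: nat list) (adj :: nat list list).
       melon_graph V E \<longrightarrow> adjacency_lists V E vs adj \<longrightarrow>
       (\<exists>(n :: nat) (\<sigma> :: state).
          exec ((card V + card E + 2) ^ d) p (input_state adj) n \<sigma> \<and>
          n \<le> c * (card V + card E) \<and>
          result \<sigma> = evc V E)"
proof (rule exI[of _ melon_program], rule exI[of _ 100], rule exI[of _ 4], intro allI impI)
  fix V :: "nat set" and E :: "nat set set" and vs :: "nat list" and adj :: "nat list list"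
  assume melon: "melon_graph V E" and input: "adjacency_lists V E vs adj"
  obtain s t Ps where Ps: "melon_paths s t Ps"
    and VE: "V = (\<Union>xs\<in>Ps. set xs)" "E = (\<Union>xs\<in>Ps. path_edges xs)"
    by (rule melon_graph_paths[OF melon])
  interpret simple_melon Ps "\<lambda>xs. length xs - 1" "(!)" s t by (rule simple_melon_of_paths[OF Ps])
  have V: "V = verts" and E: "E = edges"
    by (simp_all only: VE verts_of_paths[OF Ps] edges_of_paths[OF Ps])
  interpret melon_input Ps "\<lambda>xs. length xs - 1" "(!)" s t vs adj
    by unfold_locales (use simple_graph_melon input V E in simp_all)
  have "2 \<le> card V" unfolding V card_verts by simp
  then have "runs ((card V + card E + 2) ^ 4) melon_program 0 (input_state adj)
      (\<lambda>t \<sigma>. t \<le> 100 * card V \<and> result \<sigma> = evc V E)"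
    unfolding V E by (intro melon_program_correct word_size_bound)
  then show "\<exists>n \<sigma>. exec ((card V + card E + 2) ^ 4) melon_program (input_state adj) n \<sigma> \<and>
      n \<le> 100 * (card V + card E) \<and> result \<sigma> = evc V E"
    unfolding runs_def by (auto simp: distrib_left intro: trans_le_add1)
qed

end
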